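(* Let $X$ be a diametrically regular metric space, let $\alpha>0$ and $c_\alpha>0$, and let $\mu$ be a Borel regular measure over $X$ such that there exists a countable open covering of $X$ whose elements have finite $\mu$ measure. If $B\subset A\subset X$ are Borel sets and $\mathcal{S}_{\mu,\zeta_{b,\alpha}}$ covers $A$ finely, then $\theta^\alpha(\mu,\cdot)$ is Borel on $A$. In addition, if $\mathcal{S}^\alpha(A)<+\infty$ and the restriction of $\mu$ to $A$ is absolutely continuous with respect to the restriction of $\mathcal{S}^\alpha$ to $A$, then $$\mu(B)=\int_B\theta^\alpha(\mu,x)\,d\mathcal{S}^\alpha(x).$$
   Context: Let $d$ be the distance of $X$; for $x\in X$ and $r>0$ write $\mathbb{B}(x,r)=\{y\in X: d(x,y)\le r\}$ and $B(x,r)=\{y\in X: d(x,y)<r\}$. The metric space $X$ is diametrically regular if for all $x\in X$ and $R>0$ there exists $\delta_{x,R}>0$ such that the function $(0,\delta_{x,R})\ni t\mapsto\operatorname{diam}(B(y,t))$ is continuous for every $y\in\mathbb{B}(x,R)$. "Measure over $X$" is meant in Federer's sense: an outer measure $\mu:\mathcal{P}(X)\to[0,+\infty]$ defined on all subsets of $X$. It is Borel regular if open sets are $\mu$-measurable (in Carathéodory's sense) and every $E\subset X$ is contained in a Borel set $E'$ with $\mu(E')=\mu(E)$. The restriction of $\mu$ to $A$ is $E\mapsto\mu(A\cap E)$. Let $\mathcal{F}_b$ be the family of all closed balls $\mathbb{B}(x,r)$, $x\in X$, $r>0$, and define $\zeta_{b,\alpha}:\mathcal{F}_b\to[0,+\infty]$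 by $\zeta_{b,\alpha}(S)=c_\alpha\operatorname{diam}(S)^\alpha$. For $\delta>0$ and $R\subset X$ put $$\zeta_{b,\alpha,\delta}(R)=\inf\Big\{\sum_{j=0}^\infty\zeta_{b,\alpha}(E_j): E_j\in\mathcal{F}_b,\ \operatorname{diam}(E_j)\le\delta\ \text{for all } j\in\mathbb{N},\ R\subset\bigcup_{j\in\mathbb{N}}E_j\Big\}$$ (with $\inf\emptyset=+\infty$). The $\alpha$-dimensional spherical Hausdorff measure is $\mathcal{S}^\alpha=\sup_{\delta>0}\zeta_{b,\alpha,\delta}$. Set $$\mathcal{S}_{\mu,\zeta_{b,\alpha}}=\mathcal{F}_b\setminus\{S\in\mathcal{F}_b: \zeta_{b,\alpha}(S)=\mu(S)=0\ \text{or}\ \mu(S)=\zeta_{b,\alpha}(S)=+\infty\}.$$ The family $\mathcal{S}_{\mu,\zeta_{b,\alpha}}$ covers $A$ finely if for every $x\in A$ and every $\varepsilon>0$ there exists $S\in\mathcal{S}_{\mu,\zeta_{b,\alpha}}$ with $x\in S$ and $\operatorname{diam}S<\varepsilon$. For $S\in\mathcal{S}_{\mu,\zeta_{b,\alpha}}$ let $Q_{\mu,\zeta_{b,\alpha}}(S)=+\infty$ if $\zeta_{b,\alpha}(S)=0$, $Q_{\mu,\zeta_{b,\alpha}}(S)=\mu(S)/\zeta_{b,\alpha}(S)$ if $0<\zeta_{b,\alpha}(S)<+\infty$, and $Q_{\mu,\zeta_{b,\alpha}}(S)=0$ if $\zeta_{b,\alpha}(S)=+\infty$. At each point $x$ such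 that sets $S\in\mathcal{S}_{\mu,\zeta_{b,\alpha}}$ containing $x$ (not necessarily centered at $x$) exist with arbitrarily small diameter, define $$\theta^\alpha(\mu,x)=\inf_{\varepsilon>0}\ \sup\{Q_{\mu,\zeta_{b,\alpha}}(S): x\in S\in\mathcal{S}_{\mu,\zeta_{b,\alpha}},\ \operatorname{diam}S<\varepsilon\}.$$ *)

theory Defs
  imports "HOL-Analysis.Analysis"
begin

definition diametrically_regular :: "'a::metric_space itself \<Rightarrow> bool" where
  "diametrically_regular _ \<longleftrightarrow>
     (\<forall>(x::'a) R. R > 0 \<longrightarrow>
        (\<exists>\<delta>>0. \<forall>y\<in>cball x R. continuous_on {0<..<\<delta>} (\<lambda>t. diameter (ball y t))))"

text \<open>
  Measures in the sense of Federer are outer measures on all subsets.  The library predicate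
  \<^const>\<open>countably_subadditive\<close> only speaks about disjoint sequences; for monotone set functions
  on a power set this is equivalent to subadditivity for arbitrary sequences.
\<close>

abbreviation federer_measure :: "('a set \<Rightarrow> ennreal) \<Rightarrow> bool" where
  "federer_measure \<mu> \<equiv> outer_measure_space (Pow UNIV) \<mu>"

abbreviation caratheodory_sets :: "('a set \<Rightarrow> ennreal) \<Rightarrow> 'a set set" where
  "caratheodory_sets \<mu> \<equiv> lambda_system UNIV (Pow UNIV) \<mu>"

definition borel_regular :: "('a::topological_space set \<Rightarrow> ennreal) \<Rightarrow> bool" where
  "borel_regular \<mu> \<longleftrightarrow>
     (\<forall>U. open U \<longrightarrow> U \<in> caratheodory_sets \<mu>) \<and>
     (\<forall>E. \<exists>E'\<in>sets borel. E \<subseteq> E' \<and> \<mu> E' = \<mu> E)"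

definition outer_restrict :: "('a set \<Rightarrow> ennreal) \<Rightarrow> 'a set \<Rightarrow> 'a set \<Rightarrow> ennreal" where
  "outer_restrict \<mu> A E = \<mu> (A \<inter> E)"

definition outer_absolutely_continuous :: "('a set \<Rightarrow> ennreal) \<Rightarrow> ('a set \<Rightarrow> ennreal) \<Rightarrow> bool" where
  "outer_absolutely_continuous \<mu> \<nu> \<longleftrightarrow> (\<forall>E. \<nu> E = 0 \<longrightarrow> \<mu> E = 0)"

text \<open>
  Integration with respect to an outer measure is integration with respect to the measure it
  induces on its Caratheodory measurable sets.  (\<^const>\<open>measure_of\<close> would return the zero measure
  for a set function that is not countably additive there; the next lemma excludes this for
  outer measures.)
\<close>

definition caratheodory_measure :: "('a set \<Rightarrow> ennreal) \<Rightarrow> 'a measure" where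
  "caratheodory_measure \<mu> = measure_of UNIV (caratheodory_sets \<mu>) \<mu>"

lemma
  assumes "federer_measure \<mu>"
  shows space_caratheodory_measure: "space (caratheodory_measure \<mu>) = UNIV"
    and sets_caratheodory_measure: "sets (caratheodory_measure \<mu>) = caratheodory_sets \<mu>"
    and emeasure_caratheodory_measure:
      "E \<in> caratheodory_sets \<mu> \<Longrightarrow> emeasure (caratheodory_measure \<mu>) E = \<mu> E"
proof -
  interpret sigma_algebra UNIV "Pow UNIV :: 'a set set"
    by (rule sigma_algebra_Pow)
  have ms: "measure_space UNIV (caratheodory_sets \<mu>) \<mu>"
    using caratheodory_lemma[OF assms] .
  then have sa: "sigma_algebra UNIV (caratheodory_sets \<mu>)"
    by (simp add: measure_space_def)
  show "space (caratheodory_measure \<mu>) = UNIV"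
    by (simp add: caratheodory_measure_def space_measure_of_conv)
  show "sets (caratheodory_measure \<mu>) = caratheodory_sets \<mu>"
    unfolding caratheodory_measure_def by (rule sigma_algebra.sets_measure_of_eq[OF sa])
  show "emeasure (caratheodory_measure \<mu>) E = \<mu> E" if "E \<in> caratheodory_sets \<mu>"
    using ms that sa unfolding caratheodory_measure_def measure_space_def
    by (intro emeasure_measure_of_sigma) auto
qed

definition closed_balls :: "'a::metric_space set set" where
  "closed_balls = {cball x r | x r. r > 0}"

definition zeta_b :: "real \<Rightarrow> real \<Rightarrow> 'a::metric_space set \<Rightarrow> ennreal" where
  "zeta_b c \<alpha> S = ennreal (c * diameter S powr \<alpha>)"

definition zeta_b_delta :: "real \<Rightarrow> real \<Rightarrow> real \<Rightarrow> 'a::metric_space set \<Rightarrow> ennreal" where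
  "zeta_b_delta c \<alpha> \<delta> R =
     Inf {(\<Sum>j. zeta_b c \<alpha> (E j)) | E :: nat \<Rightarrow> 'a set.
            (\<forall>j. E j \<in> closed_balls \<and> diameter (E j) \<le> \<delta>) \<and> R \<subseteq> (\<Union>j. E j)}"

definition spherical_hausdorff :: "real \<Rightarrow> real \<Rightarrow> 'a::metric_space set \<Rightarrow> ennreal" where
  "spherical_hausdorff c \<alpha> R = (SUP \<delta>\<in>{0<..}. zeta_b_delta c \<alpha> \<delta> R)"

lemma federer_measure_spherical_hausdorff:
  assumes "\<alpha> > 0" and "c > 0"
  shows "federer_measure (spherical_hausdorff c \<alpha> :: 'a::metric_space set \<Rightarrow> ennreal)"
proof -
  let ?Z = "zeta_b_delta c \<alpha> :: real \<Rightarrow> 'a set \<Rightarrow> ennreal"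
  have mono: "?Z \<delta> R \<le> ?Z \<delta> T" if "R \<subseteq> T" for \<delta> R T
    unfolding zeta_b_delta_def using that by (intro Inf_superset_mono) blast
  have empty: "?Z \<delta> {} = 0" if "\<delta> > 0" for \<delta>
  proof -
    have "?Z \<delta> {} \<le> ennreal e" if "e > 0" for e
    proof -
      define s where "s j = min \<delta> ((e / c * (1/2) ^ Suc j) powr (1/\<alpha>))" for j
      have s: "s j > 0" for j
        using \<open>\<delta> > 0\<close> \<open>e > 0\<close> assms by (simp add: s_def)
      define E :: "nat \<Rightarrow> 'a set" where "E j = cball undefined (s j / 2)" for j
      have dia: "diameter (E j) \<le> s j" for j
      proof -
        have "dist x y \<le> s j" if "x \<in> E j" "y \<in> E j" for x y
          using that dist_triangle[of x y undefined] by (simp add: E_def dist_commute)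
        moreover have "E j \<noteq> {}"
          using s[of j] by (simp add: E_def)
        ultimately show ?thesis
          unfolding diameter_def by (auto intro!: cSUP_least)
      qed
      have z: "zeta_b c \<alpha> (E j) \<le> ennreal (e * (1/2) ^ Suc j)" for j
      proof -
        have "diameter (E j) powr \<alpha> \<le> ((e / c * (1/2) ^ Suc j) powr (1/\<alpha>)) powr \<alpha>"
          using dia[of j] assms(1) by (intro powr_mono2) (auto simp: s_def E_def diameter_ge_0)
        also have "\<dots> = e / c * (1/2) ^ Suc j"
          using assms \<open>e > 0\<close> by (simp add: powr_powr)
        finally have "diameter (E j) powr \<alpha> \<le> e * (1/2) ^ Suc j / c"
          by simp
        then show ?thesis
          using assms unfolding zeta_b_def
          by (intro ennreal_leI) (simp add: pos_le_divide_eq mult.commute)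
      qed
      have "E j \<in> closed_balls" for j
        unfolding closed_balls_def E_def using s[of j] half_gt_zero by blast
      moreover have "diameter (E j) \<le> \<delta>" for j
        using dia[of j] by (simp add: s_def)
      ultimately have "?Z \<delta> {} \<le> (\<Sum>j. zeta_b c \<alpha> (E j))"
        unfolding zeta_b_delta_def by (intro Inf_lower) blast
      also have "\<dots> \<le> (\<Sum>j. ennreal (e * (1/2) ^ Suc j))"
        using z by (intro suminf_le) auto
      also have "\<dots> = ennreal e"
        using \<open>e > 0\<close> sums_mult[OF power_half_series, of e]
        by (intro sums_unique[symmetric] sums_ennreal[THEN iffD2]) auto
      finally show ?thesis .
    qed
    then have "?Z \<delta> {} \<le> 0"
      using ennreal_le_epsilon[of 0 "?Z \<delta> {}"] by (metis add_0)
    then show ?thesis by simp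
  qed
  have sub: "?Z \<delta> (\<Union>i. R i) \<le> (\<Sum>i. ?Z \<delta> (R i))" for \<delta> and R :: "nat \<Rightarrow> 'a set"
  proof (rule ennreal_le_epsilon)
    fix e :: real
    assume fin: "(\<Sum>i. ?Z \<delta> (R i)) < top" and "e > 0"
    have "\<exists>E. (\<forall>j. E j \<in> closed_balls \<and> diameter (E j) \<le> \<delta>) \<and> R i \<subseteq> (\<Union>j. E j) \<and>
        (\<Sum>j. zeta_b c \<alpha> (E j)) < ?Z \<delta> (R i) + ennreal (e * (1/2) ^ Suc i)" for i
    proof -
      have "?Z \<delta> (R i) < top"
        using fin ennreal_suminf_lessD by blast
      then have "?Z \<delta> (R i) < ?Z \<delta> (R i) + ennreal (e * (1/2) ^ Suc i)"
        using \<open>e > 0\<close> by (simp add: ennreal_zero_less_mult_iff less_top ennreal_add_left_cancel_less)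
      then show ?thesis
        unfolding zeta_b_delta_def[of c \<alpha> \<delta> "R i"] Inf_less_iff by blast
    qed
    then obtain E where E: "\<And>i j. E i j \<in> closed_balls" "\<And>i j. diameter (E i j) \<le> \<delta>"
        "\<And>i. R i \<subseteq> (\<Union>j. E i j)"
        "\<And>i. (\<Sum>j. zeta_b c \<alpha> (E i j)) < ?Z \<delta> (R i) + ennreal (e * (1/2) ^ Suc i)"
      by metis
    define F where "F n = (case prod_decode n of (i, j) \<Rightarrow> E i j)" for n
    have "(\<Union>i. R i) \<subseteq> (\<Union>n. F n)"
    proof
      fix x assume "x \<in> (\<Union>i. R i)"
      then obtain i j where "x \<in> E i j" using E(3) by blast
      then have "x \<in> F (prod_encode (i, j))" by (simp add: F_def)
      then show "x \<in> (\<Union>n. F n)" by blast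
    qed
    moreover have "F n \<in> closed_balls \<and> diameter (F n) \<le> \<delta>" for n
      using E(1,2) by (simp add: F_def split: prod.split)
    ultimately have "?Z \<delta> (\<Union>i. R i) \<le> (\<Sum>n. zeta_b c \<alpha> (F n))"
      unfolding zeta_b_delta_def by (intro Inf_lower) blast
    also have "\<dots> = (\<Sum>i. \<Sum>j. zeta_b c \<alpha> (E i j))"
      using suminf_ennreal_2dimen[of "\<lambda>i. \<Sum>j. zeta_b c \<alpha> (E i j)" "\<lambda>(i, j). zeta_b c \<alpha> (E i j)"]
      by (simp add: F_def comp_def case_prod_beta)
    also have "\<dots> \<le> (\<Sum>i. ?Z \<delta> (R i) + ennreal (e * (1/2) ^ Suc i))"
      using E(4) by (intro suminf_le) (auto intro: less_imp_le)
    also have "\<dots> = (\<Sum>i. ?Z \<delta> (R i)) + (\<Sum>i. ennreal (e * (1/2) ^ Suc i))"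
      by (intro suminf_add[symmetric]) auto
    also have "(\<Sum>i. ennreal (e * (1/2) ^ Suc i)) = ennreal e"
      using \<open>e > 0\<close> sums_mult[OF power_half_series, of e]
      by (intro sums_unique[symmetric] sums_ennreal[THEN iffD2]) auto
    finally show "?Z \<delta> (\<Union>i. R i) \<le> (\<Sum>i. ?Z \<delta> (R i)) + ennreal e" .
  qed
  have "spherical_hausdorff c \<alpha> (\<Union>i. R i) \<le> (\<Sum>i. spherical_hausdorff c \<alpha> (R i))"
    for R :: "nat \<Rightarrow> 'a set"
    unfolding spherical_hausdorff_def
  proof (rule SUP_least)
    fix \<delta> :: real assume "\<delta> \<in> {0<..}"
    then have "(\<Sum>i. ?Z \<delta> (R i)) \<le> (\<Sum>i. SUP \<delta>\<in>{0<..}. ?Z \<delta> (R i))"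
      by (intro suminf_le SUP_upper) auto
    with sub[of \<delta> R] show "?Z \<delta> (\<Union>i. R i) \<le> (\<Sum>i. SUP \<delta>\<in>{0<..}. ?Z \<delta> (R i))"
      by (rule order_trans)
  qed
  moreover have "spherical_hausdorff c \<alpha> ({} :: 'a set) = 0"
    unfolding spherical_hausdorff_def using empty by (simp add: bot_ennreal SUP_eq_const)
  moreover have "spherical_hausdorff c \<alpha> R \<le> spherical_hausdorff c \<alpha> T" if "R \<subseteq> T" for R T :: "'a set"
    unfolding spherical_hausdorff_def using mono[OF that] by (intro SUP_mono) auto
  ultimately show ?thesis
    by (simp add: outer_measure_space_def positive_def increasing_def countably_subadditive_def)
qed

definition admissible_balls ::
    "('a::metric_space set \<Rightarrow> ennreal) \<Rightarrow> ('a set \<Rightarrow> ennreal) \<Rightarrow> 'a set set" where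
  "admissible_balls \<mu> \<zeta> =
     closed_balls - {S \<in> closed_balls. (\<zeta> S = 0 \<and> \<mu> S = 0) \<or> (\<mu> S = \<infinity> \<and> \<zeta> S = \<infinity>)}"

definition covers_finely :: "'a::metric_space set set \<Rightarrow> 'a set \<Rightarrow> bool" where
  "covers_finely \<S> A \<longleftrightarrow> (\<forall>x\<in>A. \<forall>\<epsilon>>0. \<exists>S\<in>\<S>. x \<in> S \<and> diameter S < \<epsilon>)"

definition density_quotient :: "('a set \<Rightarrow> ennreal) \<Rightarrow> ('a set \<Rightarrow> ennreal) \<Rightarrow> 'a set \<Rightarrow> ennreal" where
  "density_quotient \<mu> \<zeta> S =
     (if \<zeta> S = 0 then \<infinity> else if \<zeta> S < \<infinity> then \<mu> S / \<zeta> S else 0)"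

text \<open>
  At points not contained in admissible balls of arbitrarily small diameter, where the density is
  left undefined in the literature, the following total function has the value 0.
\<close>

definition spherical_density ::
    "real \<Rightarrow> real \<Rightarrow> ('a::metric_space set \<Rightarrow> ennreal) \<Rightarrow> 'a \<Rightarrow> ennreal" where
  "spherical_density c \<alpha> \<mu> x =
     (INF \<epsilon>\<in>{0<..}.
        SUP S\<in>{S \<in> admissible_balls \<mu> (zeta_b c \<alpha>). x \<in> S \<and> diameter S < \<epsilon>}.
          density_quotient \<mu> (zeta_b c \<alpha>) S)"

end

theory Submission
  imports Defs
begin

text \<open>
  Let \<open>\<theta>\<close> be the density.  A ball \<open>S\<close> is admissible with quotient \<open>> t\<close> iff \<open>t \<cdot> \<zeta>(S) < \<mu>(S)\<close>.
  For small \<open>\<epsilon>\<close>, diametric regularity makes the union of such balls with diameter \<open>< \<epsilon>\<close> locally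
  open, so \<open>\<theta>\<close> is locally a countable infimum of lower semicontinuous functions.

  If \<open>\<theta> < t\<close> on \<open>E\<close>, then estimating \<open>\<mu>\<close> on the balls of an efficient covering of \<open>E\<close> gives
  \<open>\<mu>(E) \<le> t \<cdot> S(E)\<close>, where \<open>S\<close> is the spherical measure.  If \<open>\<theta> > t\<close> on \<open>E\<close>, a Vitali covering by balls
  with \<open>t \<cdot> \<zeta> < \<mu>\<close> inside an open \<open>U \<supseteq> E\<close> gives \<open>t \<cdot> S(E) \<le> \<mu>(U)\<close>, hence \<open>t \<cdot> S(E) \<le> \<mu>(E)\<close> for
  Borel \<open>E\<close> by outer regularity.  The second estimate makes \<open>{\<theta> = \<infinity>}\<close> null for \<open>S\<close>, thus for \<open>\<mu>\<close> by
  absolute continuity.  On the layers \<open>{k\<eta> \<le> \<theta> < (k + 1)\<eta>}\<close> both estimates together bound the error in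
  the area formula by \<open>2\<eta> \<cdot> S(B)\<close>, and \<open>\<eta>\<close> is arbitrary.
\<close>

section \<open>Outer measures\<close>

text \<open>The tail is the total minus a partial sum. A finite total is what permits cancelling in
  \<open>ennreal\<close>.\<close>

lemma ennreal_suminf_tail_tendsto_0:
  fixes w :: "nat \<Rightarrow> ennreal"
  assumes "(\<Sum>k. w k) \<noteq> top"
  shows "(\<lambda>n. \<Sum>k. w (k + n)) \<longlonglongrightarrow> 0"
proof -
  have "(\<lambda>n. (\<Sum>k. w k) - (\<Sum>k<n. w k)) \<longlonglongrightarrow> (\<Sum>k. w k) - (\<Sum>k. w k)"
    using assms summable_LIMSEQ[of w] by (intro tendsto_diff_ennreal tendsto_const) auto
  moreover have "(\<Sum>k. w k) - (\<Sum>k<n. w k) = (\<Sum>k. w (k + n))" for n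
  proof -
    have eq: "(\<Sum>k. w k) = (\<Sum>k. w (k + n)) + (\<Sum>k<n. w k)"
      by (rule suminf_offset) auto
    with assms have "(\<Sum>k<n. w k) \<noteq> top"
      by auto
    with eq show ?thesis
      by simp
  qed
  ultimately show ?thesis
    using assms by simp
qed

text \<open>Serves to let the layer width tend to 0 in the area formula. \<open>C\<close> must be
  finite because \<open>ennreal \<eta> * top\<close> is \<open>top\<close> for every positive
  \<open>\<eta>\<close>.\<close>

lemma ennreal_le_of_le_add_mult:
  fixes a b C :: ennreal
  assumes "C < top" and le: "\<And>\<eta>::real. \<eta> > 0 \<Longrightarrow> a \<le> b + ennreal \<eta> * C"
  shows "a \<le> b"
proof (rule ennreal_le_epsilon)
  fix e :: real assume "e > 0"
  obtain r where r: "C = ennreal r" "r \<ge> 0"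
    using \<open>C < top\<close> by (cases C) auto
  \<comment> \<open>The added 1 keeps the chosen factor positive when \<open>C\<close> is 0.\<close>
  have "a \<le> b + ennreal (e / (r + 1)) * C"
    using le \<open>e > 0\<close> r by simp
  also have "ennreal (e / (r + 1)) * C \<le> ennreal e"
    using \<open>e > 0\<close> r by (simp add: field_simps flip: ennreal_mult)
  finally show "a \<le> b + ennreal e"
    by (simp add: add_left_mono)
qed

context
  fixes f :: "'a set \<Rightarrow> ennreal"
  assumes f: "federer_measure f"
begin

lemma outer_measure_mono: "P \<subseteq> Q \<Longrightarrow> f P \<le> f Q"
  using f by (auto simp: outer_measure_space_def increasing_def)

lemma outer_measure_empty: "f {} = 0"
  using f by (auto simp: outer_measure_space_def positive_def)

text \<open>\<open>countably_subadditive\<close> speaks about disjoint sequences only; disjointing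
  the sets and monotonicity extend it to all sequences.\<close>

lemma outer_measure_UN_le: "f (\<Union>i::nat. P i) \<le> (\<Sum>i. f (P i))"
proof -
  have "f (\<Union>i. disjointed P i) \<le> (\<Sum>i. f (disjointed P i))"
    using f disjoint_family_disjointed[of P]
    unfolding outer_measure_space_def countably_subadditive_def by auto
  also have "\<dots> \<le> (\<Sum>i. f (P i))"
    by (intro suminf_le outer_measure_mono disjointed_subset) auto
  finally show ?thesis
    by (simp add: UN_disjointed_eq)
qed

lemma outer_measure_Un_le: "f (P \<union> Q) \<le> f P + f Q"
  using outer_measure_UN_le[of "binaryset P Q"]
  by (simp add: UN_binaryset_eq suminf_binaryset_eq outer_measure_empty)

lemma sigma_algebra_caratheodory_sets: "sigma_algebra UNIV (caratheodory_sets f)"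
proof -
  interpret sigma_algebra UNIV "Pow UNIV :: 'a set set"
    by (rule sigma_algebra_Pow)
  show ?thesis
    using caratheodory_lemma[OF f] by (simp add: measure_space_def)
qed

end

lemma sum_even_odd: "(\<Sum>k<2 * n. w k) = (\<Sum>k<n. w (2 * k)) + (\<Sum>k<n. w (2 * k + 1))"
  for w :: "nat \<Rightarrow> 'b::comm_monoid_add" and n :: nat
proof (induction n)
  case (Suc n)
  have "2 * Suc n = Suc (Suc (2 * n))"
    by simp
  with Suc show ?case
    by (simp add: add.assoc add.left_commute)
qed simp

subsection \<open>Metric outer measures\<close>

text \<open>The hypothesis of Caratheodory's criterion, additivity on sets at positive distance.
  Only this inequality is recorded because subadditivity gives the other.\<close>

definition metric_outer_measure :: "('a::metric_space set \<Rightarrow> ennreal) \<Rightarrow> bool" where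
  "metric_outer_measure f \<longleftrightarrow> (\<forall>P Q d. d > 0 \<longrightarrow> (\<forall>x\<in>P. \<forall>y\<in>Q. d \<le> dist x y) \<longrightarrow> f P + f Q \<le> f (P \<union> Q))"

text \<open>Each set has positive distance from the finitely many before it, so the metric
  inequality splits the sets off one at a time.\<close>

lemma metric_outer_measure_sum_le:
  fixes f :: "'a::metric_space set \<Rightarrow> ennreal" and R :: "nat \<Rightarrow> 'a set"
  assumes f: "federer_measure f" and m: "metric_outer_measure f"
    and sep: "\<And>k. \<exists>d>0. \<forall>i<k. \<forall>x\<in>R i. \<forall>y\<in>R k. d \<le> dist x y"
  shows "(\<Sum>k<n. f (R k)) \<le> f (\<Union>k<n. R k)"
proof (induction n)
  case (Suc n)
  obtain d where d: "d > 0" "\<forall>i<n. \<forall>x\<in>R i. \<forall>y\<in>R n. d \<le> dist x y"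
    using sep by blast
  have "(\<Sum>k<Suc n. f (R k)) \<le> f (\<Union>k<n. R k) + f (R n)"
    using Suc.IH by (simp add: add_right_mono)
  also have "\<dots> \<le> f ((\<Union>k<n. R k) \<union> R n)"
    using m[unfolded metric_outer_measure_def, rule_format, of d "\<Union>k<n. R k" "R n"] d by auto
  also have "(\<Union>k<n. R k) \<union> R n = (\<Union>k<Suc n. R k)"
    by (simp add: lessThan_Suc Un_commute)
  finally show ?case .
qed simp

text \<open>Caratheodory's criterion. The part \<open>P n\<close> of \<open>T\<close> away from
  \<open>C\<close> is separated from \<open>C\<close>, so metric additivity applies to it and
  \<open>C \<inter> T\<close>. The rest of \<open>T - C\<close> lies in shells around
  \<open>C\<close> whose measures have a finite sum, so their tail vanishes as \<open>n\<close>
  grows.\<close>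

lemma closed_in_caratheodory_sets:
  fixes f :: "'a::metric_space set \<Rightarrow> ennreal"
  assumes f: "federer_measure f" and m: "metric_outer_measure f" and "closed C"
  shows "C \<in> caratheodory_sets f"
proof (cases "C = {}")
  case True
  then show ?thesis
    by (simp add: lambda_system_def outer_measure_empty[OF f])
next
  case False
  have "f (C \<inter> T) + f (T - C) \<le> f T" for T
  proof (cases "f T = top")
    case fin: False
    define a :: "nat \<Rightarrow> real" where "a n = 1 / Suc n" for n
    define P where "P n = {x\<in>T. a n \<le> infdist x C}" for n
    define R where "R n = {x\<in>T. a (Suc n) \<le> infdist x C \<and> infdist x C < a n}" for n
    have a_mono: "a n \<le> a k" if "k \<le> n" for k n
      using that by (simp add: a_def field_simps)
    have a_less: "a (Suc n) < a n" for n
      by (simp add: a_def field_simps)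
    \<comment> \<open>Shells with indices at least two apart are separated by the width of a shell
      between them.\<close>
    have R_dist: "a (Suc i) - a (Suc (Suc i)) \<le> dist x y"
      if "x \<in> R i" "y \<in> R k" "Suc (Suc i) \<le> k" for i k x y
    proof -
      have "a (Suc i) \<le> infdist x C" "infdist y C < a (Suc (Suc i))"
        using that a_mono[OF that(3)] by (auto simp: R_def)
      then show ?thesis
        using infdist_triangle[of x C y] by linarith
    qed
    have R_sum: "(\<Sum>k<n. f (R (2 * k + s))) \<le> f T" for n s
    proof -
      have "\<exists>d>0. \<forall>i<k. \<forall>x\<in>R (2 * i + s). \<forall>y\<in>R (2 * k + s). d \<le> dist x y" for k
      \<comment> \<open>The element 1 keeps the set nonempty for \<open>k = 0\<close>.\<close>
      proof (intro exI[of _ "Min (insert 1 ((\<lambda>i. a (Suc (2*i+s)) - a (Suc (Suc (2*i+s)))) ` {..<k}))"] conjI ballI allI impI)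
        show "0 < Min (insert 1 ((\<lambda>i. a (Suc (2*i+s)) - a (Suc (Suc (2*i+s)))) ` {..<k}))"
          using a_less by (subst Min_gr_iff) auto
      next
        fix i x y assume "i < k" "x \<in> R (2 * i + s)" "y \<in> R (2 * k + s)"
        then show "Min (insert 1 ((\<lambda>i. a (Suc (2*i+s)) - a (Suc (Suc (2*i+s)))) ` {..<k})) \<le> dist x y"
          by - (rule order_trans[OF Min_le R_dist[of x "2 * i + s" y "2 * k + s"]], auto)
      qed
      then have "(\<Sum>k<n. f (R (2 * k + s))) \<le> f (\<Union>k<n. R (2 * k + s))"
        by (intro metric_outer_measure_sum_le[OF f m]) auto
      also have "\<dots> \<le> f T"
        by (intro outer_measure_mono[OF f]) (auto simp: R_def)
      finally show ?thesis .
    qed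
    \<comment> \<open>Adjacent shells may touch, so even and odd indices are summed separately; each
      half is at most \<open>f T\<close>.\<close>
    have "(\<Sum>k<n. f (R k)) \<le> f T + f T" for n
    proof -
      have "(\<Sum>k<n. f (R k)) \<le> (\<Sum>k<2 * n. f (R k))"
        by (intro sum_mono2) auto
      also have "\<dots> \<le> f T + f T"
        using R_sum[of 0 n] R_sum[of 1 n] by (simp add: sum_even_odd add_mono)
      finally show ?thesis .
    qed
    then have "(\<Sum>k. f (R k)) \<le> f T + f T"
      by (intro suminf_le_const) auto
    also have "\<dots> < top"
      using fin by (simp add: less_top)
    finally have tail: "(\<lambda>n. \<Sum>k. f (R (k + n))) \<longlonglongrightarrow> 0"
      by (intro ennreal_suminf_tail_tendsto_0) auto
    have le: "f (C \<inter> T) + f (T - C) \<le> f T + (\<Sum>k. f (R (k + n)))" for n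
    proof -
      have "T - C \<subseteq> P n \<union> (\<Union>k. R (k + n))"
      proof
        fix x assume x: "x \<in> T - C"
        then have pos: "infdist x C > 0"
          using \<open>closed C\<close> False by (intro infdist_pos_not_in_closed) auto
        show "x \<in> P n \<union> (\<Union>k. R (k + n))"
        proof (cases "a n \<le> infdist x C")
          case True
          then show ?thesis using x by (simp add: P_def)
        next
          case less: False
          obtain N where "inverse (real (Suc N)) < infdist x C"
            using reals_Archimedean[OF pos] by blast
          then have N: "a N < infdist x C"
            by (simp only: a_def inverse_eq_divide)
          \<comment> \<open>The least level not exceeding the distance of \<open>x\<close> from
            \<open>C\<close> puts \<open>x\<close> into the shell just before it. That shell has
            index at least \<open>n\<close>, since \<open>a n\<close> exceeds the distance.\<close>
          define j where "j = (LEAST j. a j \<le> infdist x C)"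
          have j: "a j \<le> infdist x C"
            unfolding j_def using LeastI[of "\<lambda>j. a j \<le> infdist x C" N] N by simp
          have "n < j"
            using j less a_mono[of j n] by (intro not_le_imp_less) auto
          then obtain i where i: "j = Suc i"
            by (cases j) auto
          have "\<not> a i \<le> infdist x C"
            using not_less_Least[of i "\<lambda>j. a j \<le> infdist x C"] i by (simp add: j_def)
          then have "x \<in> R ((i - n) + n)"
            using x j i \<open>n < j\<close> by (auto simp: R_def)
          then show ?thesis by blast
        qed
      qed
      then have "f (T - C) \<le> f (P n) + f (\<Union>k. R (k + n))"
        by (intro order_trans[OF outer_measure_mono[OF f] outer_measure_Un_le[OF f]])
      also have "\<dots> \<le> f (P n) + (\<Sum>k. f (R (k + n)))"
        by (intro add_left_mono outer_measure_UN_le[OF f])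
      finally have le1: "f (C \<inter> T) + f (T - C) \<le> (f (C \<inter> T) + f (P n)) + (\<Sum>k. f (R (k + n)))"
        by (simp add: add.assoc add_left_mono)
      have "f (C \<inter> T) + f (P n) \<le> f (C \<inter> T \<union> P n)"
      proof (rule m[unfolded metric_outer_measure_def, rule_format, of "a n"])
        show "0 < a n" by (simp add: a_def)
        fix x y assume "x \<in> C \<inter> T" "y \<in> P n"
        then show "a n \<le> dist x y"
          using infdist_le[of x C y] by (auto simp: P_def dist_commute)
      qed
      moreover have "f (C \<inter> T \<union> P n) \<le> f T"
        by (intro outer_measure_mono[OF f]) (auto simp: P_def)
      ultimately have "f (C \<inter> T) + f (P n) \<le> f T"
        by (rule order_trans)
      then have "(f (C \<inter> T) + f (P n)) + (\<Sum>k. f (R (k + n))) \<le> f T + (\<Sum>k. f (R (k + n)))"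
        by (rule add_right_mono)
      with le1 show ?thesis
        by (rule order_trans)
    qed
    have "(\<lambda>n. f T + (\<Sum>k. f (R (k + n)))) \<longlonglongrightarrow> f T + 0"
      by (intro tendsto_add tendsto_const tail)
    then show ?thesis
      using le by (intro LIMSEQ_le_const) auto
  qed simp
  moreover have "f T \<le> f (C \<inter> T) + f (T - C)" for T
    using outer_measure_Un_le[OF f, of "C \<inter> T" "T - C"] by (metis Int_Diff_Un Int_commute)
  moreover have "(UNIV - C) \<inter> T = T - C" for T
    by blast
  ultimately have "f (C \<inter> T) + f ((UNIV - C) \<inter> T) = f T" for T
    by (metis antisym)
  then show ?thesis
    unfolding lambda_system_def by blast
qed

lemma borel_subset_sigma_algebra:
  assumes "sigma_algebra UNIV (L :: 'a::topological_space set set)" and "\<And>U. open U \<Longrightarrow> U \<in> L"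
  shows "sets borel \<subseteq> L"
proof -
  interpret sigma_algebra UNIV L by fact
  have "sets (borel :: 'a measure) = sigma_sets UNIV {S. open S}"
    by (simp add: borel_def)
  also have "\<dots> \<subseteq> L"
    using assms(2) by (intro sigma_sets_subset) auto
  finally show ?thesis .
qed

lemma borel_subset_caratheodory_sets_metric:
  fixes f :: "'a::metric_space set \<Rightarrow> ennreal"
  assumes f: "federer_measure f" and m: "metric_outer_measure f"
  shows "sets borel \<subseteq> caratheodory_sets f"
proof (rule borel_subset_sigma_algebra[OF sigma_algebra_caratheodory_sets[OF f]])
  fix U :: "'a set" assume "open U"
  interpret sigma_algebra UNIV "caratheodory_sets f"
    by (rule sigma_algebra_caratheodory_sets[OF f])
  have "UNIV - U \<in> caratheodory_sets f"
    using \<open>open U\<close> by (intro closed_in_caratheodory_sets[OF f m]) (auto simp: Compl_eq_Diff_UNIV[symmetric])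
  then have "UNIV - (UNIV - U) \<in> caratheodory_sets f"
    by (rule compl_sets)
  then show "U \<in> caratheodory_sets f"
    by (simp only: double_diff[OF subset_UNIV order_refl] Diff_Diff_Int Int_UNIV_left)
qed

section \<open>Regularity of Borel measures\<close>

lemma open_eq_UN_closed:
  fixes U :: "'a::metric_space set"
  assumes "open U"
  obtains C where "\<And>n::nat. closed (C n)" "incseq C" "(\<Union>n. C n) = U"
\<comment> \<open>\<open>infdist\<close> to the empty set is 0 by convention, so the distance to the
  complement cannot describe the whole space.\<close>
proof (cases "U = UNIV")
  case True
  show ?thesis
    by (rule that[of "\<lambda>_. UNIV"]) (simp_all add: True)
next
  case False
  define C where "C n = {x. 1 / real (Suc n) \<le> infdist x (- U)}" for n
  show ?thesis
  proof (rule that)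
    show "closed (C n)" for n
      unfolding C_def by (intro closed_Collect_le continuous_intros)
    show "incseq C"
    proof (rule monoI)
      fix m n :: nat assume "m \<le> n"
      then have "1 / real (Suc n) \<le> 1 / real (Suc m)"
        by (simp add: field_simps)
      then show "C m \<subseteq> C n"
        unfolding C_def by auto
    qed
    have "infdist x (- U) > 0 \<longleftrightarrow> x \<in> U" for x
      using infdist_pos_not_in_closed[of "- U" x] \<open>open U\<close> False infdist_zero[of x "- U"]
      by (cases "x \<in> U") auto
    moreover have "(\<exists>n. 1 / real (Suc n) \<le> r) \<longleftrightarrow> r > 0" for r
    proof
      assume "\<exists>n. 1 / real (Suc n) \<le> r"
      then obtain n where "1 / real (Suc n) \<le> r" by blast
      moreover have "0 < 1 / real (Suc n)" by simp
      ultimately show "r > 0" by linarith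
    next
      assume "r > 0"
      then obtain n where "inverse (real (Suc n)) < r"
        using reals_Archimedean by blast
      then have "1 / real (Suc n) \<le> r"
        by (simp only: inverse_eq_divide)
      then show "\<exists>n. 1 / real (Suc n) \<le> r" ..
    qed
    ultimately show "(\<Union>n. C n) = U"
      by (auto simp: C_def)
  qed
qed

text \<open>The sets with such a two-sided approximation form a sigma-algebra: complements exchange
  the two roles. It contains the open sets because these are increasing unions of closed
  sets.\<close>

lemma finite_borel_measure_closed_open_approx:
  fixes M :: "'a::metric_space measure"
  assumes M: "sets M = sets borel" and fin: "emeasure M UNIV < top" and "E \<in> sets borel"
  shows "\<forall>e>0. \<exists>U C. open U \<and> closed C \<and> C \<subseteq> E \<and> E \<subseteq> U \<and> emeasure M (U - C) < ennreal e"
proof -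
  \<comment> \<open>Continuity from above; finiteness of the measure enters here.\<close>
  have small: "\<exists>n. emeasure M (D n) < ennreal e"
    if "\<And>n. D n \<in> sets borel" "decseq D" "(\<Inter>n. D n) = {}" "e > 0" for D :: "nat \<Rightarrow> 'a set" and e :: real
  proof -
    have "emeasure M (D n) \<noteq> top" for n
      using fin emeasure_mono[of "D n" UNIV M] M by (auto simp: less_top)
    then have "(\<lambda>n. emeasure M (D n)) \<longlonglongrightarrow> emeasure M (\<Inter>n. D n)"
      using that(1,2) M by (intro Lim_emeasure_decseq) auto
    then have "eventually (\<lambda>n. emeasure M (D n) < ennreal e) sequentially"
      using that(3,4) by (intro order_tendstoD(2)[where a = "ennreal e"]) auto
    then show ?thesis
      by (auto simp: eventually_sequentially)
  qed
  have "E \<in> sigma_sets UNIV {S. open S}"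
    using \<open>E \<in> sets borel\<close> by (simp add: borel_def)
  then show ?thesis
  proof (induction rule: sigma_sets.induct)
    case (Basic U)
    then have U: "open U" by simp
    obtain C where C: "\<And>n::nat. closed (C n)" "incseq C" "(\<Union>n. C n) = U"
      using open_eq_UN_closed[OF U] by metis
    show ?case
    proof (intro allI impI)
      fix e :: real assume "e > 0"
      have "\<exists>n. emeasure M (U - C n) < ennreal e"
      proof (rule small)
        show "U - C n \<in> sets borel" for n
          using U C(1) by (intro sets.Diff) auto
        show "decseq (\<lambda>n. U - C n)"
          using C(2) by (auto simp: decseq_def incseq_def)
        show "(\<Inter>n. U - C n) = {}"
          unfolding C(3)[symmetric] by blast
      qed fact
      then obtain n where "emeasure M (U - C n) < ennreal e" ..
      then show "\<exists>V C. open V \<and> closed C \<and> C \<subseteq> U \<and> U \<subseteq> V \<and> emeasure M (V - C) < ennreal e"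
        using U C(1)[of n] C(3) by (intro exI[of _ U] exI[of _ "C n"]) auto
    qed
  next
    case Empty
    show ?case
      by (intro allI impI exI[of _ "{}"]) auto
  next
    case (Compl E)
    show ?case
    proof (intro allI impI)
      fix e :: real assume "e > 0"
      obtain U C where "open U" "closed C" "C \<subseteq> E" "E \<subseteq> U" "emeasure M (U - C) < ennreal e"
        using Compl.IH[rule_format, OF \<open>e > 0\<close>] by (elim exE conjE) (rule that)
      moreover have "- C - - U = U - C"
        by blast
      ultimately show "\<exists>U C. open U \<and> closed C \<and> C \<subseteq> UNIV - E \<and> UNIV - E \<subseteq> U \<and> emeasure M (U - C) < ennreal e"
        by (intro exI[of _ "- C"] exI[of _ "- U"]) auto
    qed
  next
    case (Union E)
    show ?case
    proof (intro allI impI)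
      fix e :: real assume "e > 0"
      \<comment> \<open>These errors add up to \<open>e / 2\<close>. The other half pays for
        replacing the union of the \<open>C i\<close>, which need not be closed, by a finite
        one.\<close>
      have "\<forall>i. \<exists>U C. open U \<and> closed C \<and> C \<subseteq> E i \<and> E i \<subseteq> U \<and> emeasure M (U - C) < ennreal (e / 2 * (1/2) ^ Suc i)"
        using Union.IH \<open>e > 0\<close> by simp
      then obtain U C where UC: "\<And>i. open (U i)" "\<And>i. closed (C i)" "\<And>i. C i \<subseteq> E i" "\<And>i. E i \<subseteq> U i"
          "\<And>i. emeasure M (U i - C i) < ennreal (e / 2 * (1/2) ^ Suc i)"
        by metis
      have "(\<Union>i. U i) - (\<Union>i. C i) \<subseteq> (\<Union>i. U i - C i)"
        by blast
      then have "emeasure M ((\<Union>i. U i) - (\<Union>i. C i)) \<le> emeasure M (\<Union>i. U i - C i)"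
        using UC(1,2) M by (intro emeasure_mono) auto
      also have "\<dots> \<le> (\<Sum>i. emeasure M (U i - C i))"
        using UC(1,2) M by (intro emeasure_subadditive_countably) auto
      also have "\<dots> \<le> (\<Sum>i. ennreal (e / 2 * (1/2) ^ Suc i))"
        using UC by (intro suminf_le) (auto intro: less_imp_le)
      also have "\<dots> = ennreal (e / 2)"
        using \<open>e > 0\<close> sums_mult[OF power_half_series, of "e / 2"]
        by (intro sums_unique[symmetric] sums_ennreal[THEN iffD2]) auto
      finally have 1: "emeasure M ((\<Union>i. U i) - (\<Union>i. C i)) \<le> ennreal (e / 2)" .
      have C_borel: "(\<Union>i\<le>n. C i) \<in> sets borel" "(\<Union>i. C i) \<in> sets borel" for n
        using UC(2) by auto
      have "\<exists>n. emeasure M ((\<Union>i. C i) - (\<Union>i\<le>n. C i)) < ennreal (e / 2)"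
      proof (rule small)
        show "(\<Union>i. C i) - (\<Union>i\<le>n. C i) \<in> sets borel" for n
          using C_borel by (intro sets.Diff)
        show "decseq (\<lambda>n. (\<Union>i. C i) - (\<Union>i\<le>n. C i))"
          unfolding decseq_def by (intro allI impI Diff_mono UN_mono) auto
      qed (use \<open>e > 0\<close> in auto)
      then obtain n where n: "emeasure M ((\<Union>i. C i) - (\<Union>i\<le>n. C i)) < ennreal (e / 2)" ..
      have U_borel: "(\<Union>i. U i) \<in> sets borel"
        using UC(1) by auto
      have "emeasure M ((\<Union>i. U i) - (\<Union>i\<le>n. C i)) \<le>
          emeasure M (((\<Union>i. U i) - (\<Union>i. C i)) \<union> ((\<Union>i. C i) - (\<Union>i\<le>n. C i)))"
        using C_borel U_borel M by (intro emeasure_mono) auto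
      also have "\<dots> \<le> emeasure M ((\<Union>i. U i) - (\<Union>i. C i)) + emeasure M ((\<Union>i. C i) - (\<Union>i\<le>n. C i))"
        using C_borel U_borel M by (intro emeasure_subadditive) auto
      also have "\<dots> \<le> ennreal (e / 2) + emeasure M ((\<Union>i. C i) - (\<Union>i\<le>n. C i))"
        using 1 by (rule add_right_mono)
      also have "\<dots> < ennreal (e / 2) + ennreal (e / 2)"
        using n by (simp add: ennreal_add_left_cancel_less)
      also have "\<dots> = ennreal e"
        using \<open>e > 0\<close> by (simp flip: ennreal_plus)
      finally have "emeasure M ((\<Union>i. U i) - (\<Union>i\<le>n. C i)) < ennreal e" .
      moreover have "open (\<Union>i. U i)" "closed (\<Union>i\<le>n. C i)"
        using UC(1,2) by auto
      moreover have "(\<Union>i\<le>n. C i) \<subseteq> (\<Union>i. E i)" "(\<Union>i. E i) \<subseteq> (\<Union>i. U i)"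
        using UC(3,4) by blast+
      ultimately show "\<exists>U C. open U \<and> closed C \<and> C \<subseteq> (\<Union>i. E i) \<and> (\<Union>i. E i) \<subseteq> U \<and> emeasure M (U - C) < ennreal e"
        by (intro exI[of _ "\<Union>i. U i"] exI[of _ "\<Union>i\<le>n. C i"] conjI)
    qed
  qed
qed

text \<open>The finite case applies to \<open>M\<close> restricted to each \<open>V i\<close>. The
  open sets found there are cut down to \<open>V i\<close>, and their errors are summed over
  \<open>i\<close>.\<close>

lemma borel_measure_outer_regular:
  fixes M :: "'a::metric_space measure"
  assumes M: "sets M = sets borel"
    and V: "\<And>i::nat. open (V i)" "\<And>i. emeasure M (V i) < top" "(\<Union>i. V i) = UNIV"
    and E: "E \<in> sets borel" and "e > 0"
  obtains U where "open U" "E \<subseteq> U" "emeasure M U \<le> emeasure M E + ennreal e"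
proof -
  have "\<exists>U. open U \<and> E \<inter> V i \<subseteq> U \<and> emeasure M (U - E) < ennreal (e * (1/2) ^ Suc i)" for i
  proof -
    define N where "N = density M (indicator (V i))"
    have N: "emeasure N X = emeasure M (X \<inter> V i)" if "X \<in> sets borel" for X
      using that V(1)[of i] M unfolding N_def
      by (subst emeasure_restricted) (auto simp: Int_commute)
    have sN: "sets N = sets borel"
      by (simp add: N_def M)
    have fN: "emeasure N UNIV < top"
      using V(2) by (simp add: N)
    have pos: "e * (1/2) ^ Suc i > 0"
      using \<open>e > 0\<close> by simp
    obtain U C where U: "open U" "closed C" "C \<subseteq> E" "E \<subseteq> U" "emeasure N (U - C) < ennreal (e * (1/2) ^ Suc i)"
      using finite_borel_measure_closed_open_approx[OF sN fN E, rule_format, OF pos] by (elim exE conjE) (rule that)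
    have "emeasure M (U \<inter> V i - E) \<le> emeasure M ((U - C) \<inter> V i)"
      using U V M by (intro emeasure_mono) auto
    also have "\<dots> < ennreal (e * (1/2) ^ Suc i)"
      using U N[of "U - C"] by auto
    finally show ?thesis
      using U V by (intro exI[of _ "U \<inter> V i"]) auto
  qed
  then obtain U where U: "\<And>i. open (U i)" "\<And>i. E \<inter> V i \<subseteq> U i" "\<And>i. emeasure M (U i - E) < ennreal (e * (1/2) ^ Suc i)"
    by metis
  show ?thesis
  proof (rule that)
    show "open (\<Union>i. U i)"
      using U by auto
    show "E \<subseteq> (\<Union>i. U i)"
    proof
      fix x assume "x \<in> E"
      have "x \<in> (\<Union>i. V i)"
        by (simp add: V(3))
      then obtain i where "x \<in> V i" ..
      with \<open>x \<in> E\<close> U(2)[of i] show "x \<in> (\<Union>i. U i)"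
        by auto
    qed
    have D: "(\<Union>i. U i - E) \<in> sets borel" "\<And>i. U i - E \<in> sets borel"
      using U(1) E by auto
    have "emeasure M (\<Union>i. U i) \<le> emeasure M (E \<union> (\<Union>i. U i - E))"
      using U(1) E D M by (intro emeasure_mono) auto
    also have "\<dots> \<le> emeasure M E + emeasure M (\<Union>i. U i - E)"
      using E D M by (intro emeasure_subadditive) auto
    also have "emeasure M (\<Union>i. U i - E) \<le> (\<Sum>i. emeasure M (U i - E))"
      using D M by (intro emeasure_subadditive_countably) auto
    also have "\<dots> \<le> (\<Sum>i. ennreal (e * (1/2) ^ Suc i))"
      using U by (intro suminf_le) (auto intro: less_imp_le)
    also have "\<dots> = ennreal e"
      using \<open>e > 0\<close> sums_mult[OF power_half_series, of e]
      by (intro sums_unique[symmetric] sums_ennreal[THEN iffD2]) auto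
    finally show "emeasure M (\<Union>i. U i) \<le> emeasure M E + ennreal e"
      by (simp add: add_left_mono)
  qed
qed

section \<open>Closed balls and the spherical Hausdorff measure\<close>

lemma diameter_cball_le:
  fixes x :: "'a::metric_space"
  assumes "r \<ge> 0"
  shows "diameter (cball x r) \<le> 2 * r"
proof -
  have "dist y z \<le> 2 * r" if "y \<in> cball x r" "z \<in> cball x r" for y z
    using that dist_triangle[of y z x] by (simp add: dist_commute)
  then show ?thesis
    using assms unfolding diameter_def by (auto intro!: cSUP_least)
qed

lemma cball_in_closed_balls [simp]: "r > 0 \<Longrightarrow> cball x r \<in> closed_balls"
  unfolding closed_balls_def by blast

lemma closed_balls_props:
  assumes "S \<in> closed_balls"
  shows "bounded S" "closed S" "S \<noteq> {}" "diameter S \<ge> 0"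
  using assms by (auto simp: closed_balls_def intro!: diameter_ge_0)

lemma dist_le_diameter_closed_ball:
  "S \<in> closed_balls \<Longrightarrow> x \<in> S \<Longrightarrow> y \<in> S \<Longrightarrow> dist x y \<le> diameter S"
  by (intro diameter_bounded_bound closed_balls_props)

text \<open>The radius of a closed ball may be much larger than its diameter; it can be shrunk without
  changing the ball.\<close>

lemma closed_ball_eq_cball_small_radius:
  assumes S: "S \<in> closed_balls" and "diameter S < \<epsilon>"
  obtains y r where "S = cball y r" "0 < r" "r < \<epsilon>"
proof -
  obtain y r0 where yr: "S = cball y r0" "r0 > 0"
    using S by (auto simp: closed_balls_def)
  have "diameter S \<ge> 0"
    using closed_balls_props[OF S] by simp
  \<comment> \<open>Shrinking the radius down to the diameter loses no point of \<open>S\<close>.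
    The maximum with \<open>\<epsilon> / 2\<close> keeps it positive when the diameter is 0.\<close>
  define r where "r = min r0 (max (diameter S) (\<epsilon> / 2))"
  have "S = cball y r"
  proof (intro equalityI subsetI)
    fix z assume "z \<in> S"
    then have "dist y z \<le> diameter S" "dist y z \<le> r0"
      using yr dist_le_diameter_closed_ball[OF S, of y z] by auto
    then show "z \<in> cball y r"
      by (auto simp: r_def)
  qed (simp add: yr r_def)
  moreover have "0 < r" "r < \<epsilon>"
    using yr \<open>diameter S \<ge> 0\<close> \<open>diameter S < \<epsilon>\<close> by (auto simp: r_def)
  ultimately show ?thesis
    by (rule that)
qed

context
  fixes c \<alpha> :: real
  assumes \<alpha>: "\<alpha> > 0" and c: "c > 0"
begin

lemma zeta_b_less_top [simp]: "zeta_b c \<alpha> S < top"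
  by (simp add: zeta_b_def)

lemma zeta_b_le:
  assumes "S \<in> closed_balls" "diameter S \<le> d"
  shows "zeta_b c \<alpha> S \<le> ennreal (c * d powr \<alpha>)"
  using assms \<alpha> c closed_balls_props(4)[OF assms(1)]
  by (auto simp: zeta_b_def intro!: ennreal_leI mult_left_mono powr_mono2)

lemma ex_small_closed_ball:
  assumes "\<delta> > 0" "e > 0"
  shows "\<exists>T\<in>closed_balls. diameter T \<le> \<delta> \<and> zeta_b c \<alpha> (T :: 'a::metric_space set) \<le> ennreal e"
proof -
  define s where "s = min \<delta> ((e / c) powr (1 / \<alpha>))"
  have s: "s > 0"
    using assms c by (simp add: s_def)
  define T :: "'a set" where "T = cball undefined (s / 2)"
  have T: "T \<in> closed_balls"
    using s by (simp add: T_def)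
  have d: "diameter T \<le> s"
    using diameter_cball_le[of "s / 2" undefined] s by (simp add: T_def)
  have "zeta_b c \<alpha> T \<le> ennreal (c * s powr \<alpha>)"
    by (rule zeta_b_le[OF T d])
  also have "s powr \<alpha> \<le> ((e / c) powr (1 / \<alpha>)) powr \<alpha>"
    using s \<alpha> by (intro powr_mono2) (auto simp: s_def)
  then have "c * s powr \<alpha> \<le> c * (e / c)"
    using c \<alpha> \<open>e > 0\<close> by (intro mult_left_mono) (auto simp: powr_powr)
  then have "ennreal (c * s powr \<alpha>) \<le> ennreal e"
    using c by (intro ennreal_leI) simp
  finally show ?thesis
    using T d by (intro bexI[of _ T]) (auto simp: s_def)
qed

text \<open>Admits coverings indexed by any set of naturals: places outside \<open>I\<close> receive
  filler balls of total weight at most \<open>e\<close>, for arbitrary positive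
  \<open>e\<close>.\<close>

lemma zeta_b_delta_le_suminf:
  fixes f :: "nat \<Rightarrow> 'a::metric_space set"
  assumes "\<delta> > 0"
    and f: "\<And>j. j \<in> I \<Longrightarrow> f j \<in> closed_balls" "\<And>j. j \<in> I \<Longrightarrow> diameter (f j) \<le> \<delta>" "R \<subseteq> (\<Union>j\<in>I. f j)"
  shows "zeta_b_delta c \<alpha> \<delta> R \<le> (\<Sum>j. if j \<in> I then zeta_b c \<alpha> (f j) else 0)"
proof (rule ennreal_le_epsilon)
  fix e :: real assume "e > 0"
  have "\<exists>T\<in>closed_balls. diameter T \<le> \<delta> \<and> zeta_b c \<alpha> (T :: 'a set) \<le> ennreal (e * (1/2) ^ Suc j)" for j
    using \<open>e > 0\<close> \<open>\<delta> > 0\<close> by (intro ex_small_closed_ball) auto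
  then obtain T :: "nat \<Rightarrow> 'a set" where T: "\<And>j. T j \<in> closed_balls" "\<And>j. diameter (T j) \<le> \<delta>"
      "\<And>j. zeta_b c \<alpha> (T j) \<le> ennreal (e * (1/2) ^ Suc j)"
    by metis
  define E where "E j = (if j \<in> I then f j else T j)" for j
  have "(\<forall>j. E j \<in> closed_balls \<and> diameter (E j) \<le> \<delta>) \<and> R \<subseteq> (\<Union>j. E j)"
  proof (intro conjI allI)
    show "R \<subseteq> (\<Union>j. E j)"
      using f(3) by (rule order_trans) (auto simp: E_def)
  qed (use f T in \<open>auto simp: E_def\<close>)
  then have "zeta_b_delta c \<alpha> \<delta> R \<le> (\<Sum>j. zeta_b c \<alpha> (E j))"
    unfolding zeta_b_delta_def by (intro Inf_lower CollectI exI[of _ E]) simp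
  also have "\<dots> \<le> (\<Sum>j. (if j \<in> I then zeta_b c \<alpha> (f j) else 0) + ennreal (e * (1/2) ^ Suc j))"
    using T by (intro suminf_le) (auto simp: E_def)
  also have "\<dots> = (\<Sum>j. if j \<in> I then zeta_b c \<alpha> (f j) else 0) + (\<Sum>j. ennreal (e * (1/2) ^ Suc j))"
    by (intro suminf_add[symmetric]) auto
  also have "(\<Sum>j. ennreal (e * (1/2) ^ Suc j)) = ennreal e"
    using \<open>e > 0\<close> sums_mult[OF power_half_series, of e]
    by (intro sums_unique[symmetric] sums_ennreal[THEN iffD2]) auto
  finally show "zeta_b_delta c \<alpha> \<delta> R \<le> (\<Sum>j. if j \<in> I then zeta_b c \<alpha> (f j) else 0) + ennreal e" .
qed

lemma zeta_b_delta_antimono: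
  fixes R :: "'a::metric_space set"
  assumes "\<delta> \<le> \<delta>'"
  shows "zeta_b_delta c \<alpha> \<delta>' R \<le> zeta_b_delta c \<alpha> \<delta> R"
  unfolding zeta_b_delta_def
proof (intro Inf_superset_mono Collect_mono impI, elim exE conjE)
  fix z and E :: "nat \<Rightarrow> 'a set"
  assume "z = (\<Sum>j. zeta_b c \<alpha> (E j))" "\<forall>j. E j \<in> closed_balls \<and> diameter (E j) \<le> \<delta>" "R \<subseteq> (\<Union>j. E j)"
  moreover from this(2) have "\<forall>j. E j \<in> closed_balls \<and> diameter (E j) \<le> \<delta>'"
    using assms by (meson order_trans)
  ultimately show "\<exists>E. z = (\<Sum>j. zeta_b c \<alpha> (E j)) \<and> (\<forall>j. E j \<in> closed_balls \<and> diameter (E j) \<le> \<delta>') \<and> R \<subseteq> (\<Union>j. E j)"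
    by blast
qed

lemma zeta_b_delta_le_spherical_hausdorff: "\<delta> > 0 \<Longrightarrow> zeta_b_delta c \<alpha> \<delta> R \<le> spherical_hausdorff c \<alpha> R"
  unfolding spherical_hausdorff_def by (rule SUP_upper) simp

text \<open>A ball of diameter below \<open>d\<close> cannot meet both \<open>P\<close> and
  \<open>Q\<close>, so a covering of the union contains coverings of the two sets with disjoint
  index sets.\<close>

lemma zeta_b_delta_Un_ge:
  fixes P Q :: "'a::metric_space set"
  assumes "\<delta> > 0" "\<delta> < d" and sep: "\<And>x y. x \<in> P \<Longrightarrow> y \<in> Q \<Longrightarrow> d \<le> dist x y"
  shows "zeta_b_delta c \<alpha> \<delta> P + zeta_b_delta c \<alpha> \<delta> Q \<le> zeta_b_delta c \<alpha> \<delta> (P \<union> Q)"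
  unfolding zeta_b_delta_def[of c \<alpha> \<delta> "P \<union> Q"]
proof (rule Inf_greatest, elim CollectE exE conjE)
  fix z :: ennreal and E :: "nat \<Rightarrow> 'a set"
  assume z: "z = (\<Sum>j. zeta_b c \<alpha> (E j))" and E: "\<forall>j. E j \<in> closed_balls \<and> diameter (E j) \<le> \<delta>"
    and cov: "P \<union> Q \<subseteq> (\<Union>j. E j)"
  define I where "I = {j. E j \<inter> P \<noteq> {}}"
  define J where "J = {j. E j \<inter> Q \<noteq> {}}"
  have disj: "j \<notin> J" if j: "j \<in> I" for j
  proof
    assume "j \<in> J"
    with j obtain x y where xy: "x \<in> E j" "x \<in> P" "y \<in> E j" "y \<in> Q"
      unfolding I_def J_def by blast
    have "d \<le> dist x y"
      using sep xy by blast
    also have "dist x y \<le> \<delta>"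
      using dist_le_diameter_closed_ball[of "E j" x y] E[rule_format, of j] xy by linarith
    finally show False
      using \<open>\<delta> < d\<close> by simp
  qed
  have "P \<subseteq> (\<Union>j\<in>I. E j)" "Q \<subseteq> (\<Union>j\<in>J. E j)"
    using cov unfolding I_def J_def by blast+
  then have "zeta_b_delta c \<alpha> \<delta> P + zeta_b_delta c \<alpha> \<delta> Q \<le>
      (\<Sum>j. if j \<in> I then zeta_b c \<alpha> (E j) else 0) + (\<Sum>j. if j \<in> J then zeta_b c \<alpha> (E j) else 0)"
    using E \<open>\<delta> > 0\<close> by (intro add_mono zeta_b_delta_le_suminf) auto
  also have "\<dots> = (\<Sum>j. (if j \<in> I then zeta_b c \<alpha> (E j) else 0) + (if j \<in> J then zeta_b c \<alpha> (E j) else 0))"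
    by (intro suminf_add) auto
  also have "\<dots> \<le> z"
    unfolding z using disj by (intro suminf_le) auto
  finally show "zeta_b_delta c \<alpha> \<delta> P + zeta_b_delta c \<alpha> \<delta> Q \<le> z" .
qed

lemma metric_outer_measure_spherical_hausdorff:
  "metric_outer_measure (spherical_hausdorff c \<alpha> :: 'a::metric_space set \<Rightarrow> ennreal)"
  unfolding metric_outer_measure_def
proof (intro allI impI)
  fix P Q :: "'a set" and d :: real
  assume "d > 0" and sep: "\<forall>x\<in>P. \<forall>y\<in>Q. d \<le> dist x y"
  have "zeta_b_delta c \<alpha> \<delta>1 P + zeta_b_delta c \<alpha> \<delta>2 Q \<le> spherical_hausdorff c \<alpha> (P \<union> Q)"
    if "\<delta>1 > 0" "\<delta>2 > 0" for \<delta>1 \<delta>2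
  proof -
    \<comment> \<open>A common scale below both given ones and below the separation
      \<open>d\<close>; passing to it only increases the two terms.\<close>
    define \<delta> where "\<delta> = min (min \<delta>1 \<delta>2) (d / 2)"
    have \<delta>: "\<delta> > 0" "\<delta> < d" "\<delta> \<le> \<delta>1" "\<delta> \<le> \<delta>2"
      using that \<open>d > 0\<close> by (auto simp: \<delta>_def)
    have "zeta_b_delta c \<alpha> \<delta>1 P + zeta_b_delta c \<alpha> \<delta>2 Q \<le> zeta_b_delta c \<alpha> \<delta> P + zeta_b_delta c \<alpha> \<delta> Q"
      using \<delta> by (intro add_mono zeta_b_delta_antimono)
    also have "\<dots> \<le> zeta_b_delta c \<alpha> \<delta> (P \<union> Q)"
      using \<delta> sep by (intro zeta_b_delta_Un_ge[of \<delta> d]) auto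
    also have "\<dots> \<le> spherical_hausdorff c \<alpha> (P \<union> Q)"
      using \<delta>(1) by (rule zeta_b_delta_le_spherical_hausdorff)
    finally show ?thesis .
  qed
  then have "(SUP \<delta>2\<in>{0<..}. (SUP \<delta>1\<in>{0<..}. zeta_b_delta c \<alpha> \<delta>1 P + zeta_b_delta c \<alpha> \<delta>2 Q))
      \<le> spherical_hausdorff c \<alpha> (P \<union> Q)"
    by (intro SUP_least) auto
  also have "(SUP \<delta>2\<in>{0<..}. (SUP \<delta>1\<in>{0<..}. zeta_b_delta c \<alpha> \<delta>1 P + zeta_b_delta c \<alpha> \<delta>2 Q))
      = spherical_hausdorff c \<alpha> P + spherical_hausdorff c \<alpha> Q"
    by (simp add: spherical_hausdorff_def ennreal_SUP_add_left ennreal_SUP_add_right)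
  finally show "spherical_hausdorff c \<alpha> P + spherical_hausdorff c \<alpha> Q \<le> spherical_hausdorff c \<alpha> (P \<union> Q)" .
qed

end

section \<open>Measurability of the density\<close>

lemma ennreal_divide_le_iff:
  fixes t a b :: ennreal
  assumes "b \<noteq> 0" "b < top"
  shows "a / b \<le> t \<longleftrightarrow> a \<le> t * b"
proof
  assume "a / b \<le> t"
  then have "a / b * b \<le> t * b"
    by (rule mult_right_mono) simp
  then show "a \<le> t * b"
    using assms by (simp add: ennreal_divide_times ennreal_divide_self)
next
  assume "a \<le> t * b"
  then have "a / b \<le> t * b / b"
    by (rule divide_right_mono_ennreal)
  then show "a / b \<le> t"
    using assms by (simp add: ennreal_mult_divide_eq)
qed

lemma ennreal_less_divide_iff: "b \<noteq> 0 \<Longrightarrow> b < top \<Longrightarrow> t < a / b \<longleftrightarrow> t * b < a"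
  for t a b :: ennreal
  using ennreal_divide_le_iff[of b a t] by (simp add: not_le[symmetric])

text \<open>If \<open>zeta_b c \<alpha> S\<close> is 0, admissibility means that
  \<open>\<mu> S\<close> is positive, and the quotient is infinite, hence above the finite
  \<open>t\<close>. Otherwise the denominator, which is always finite, can be cleared.\<close>

lemma admissible_density_quotient_gt_iff:
  assumes \<alpha>: "\<alpha> > 0" and c: "c > 0" and "t < top"
  shows "S \<in> admissible_balls \<mu> (zeta_b c \<alpha>) \<and> t < density_quotient \<mu> (zeta_b c \<alpha>) S \<longleftrightarrow>
    S \<in> closed_balls \<and> t * zeta_b c \<alpha> S < \<mu> S"
proof (cases "zeta_b c \<alpha> S = 0")
  case True
  then show ?thesis
    using \<open>t < top\<close> by (auto simp: admissible_balls_def density_quotient_def zero_less_iff_neq_zero)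
next
  case False
  then show ?thesis
    using ennreal_less_divide_iff[OF False zeta_b_less_top[OF \<alpha> c], of t "\<mu> S"] zeta_b_less_top[OF \<alpha> c, of S]
    by (auto simp: admissible_balls_def density_quotient_def less_top[symmetric])
qed

text \<open>The strict superlevel set of \<open>upper_quotient\<close> at a finite level
  \<open>t\<close>, by \<open>less_upper_quotient_iff\<close>.\<close>

definition exceeding_points :: "real \<Rightarrow> real \<Rightarrow> ('a::metric_space set \<Rightarrow> ennreal) \<Rightarrow> ennreal \<Rightarrow> real \<Rightarrow> 'a set" where
  "exceeding_points c \<alpha> \<mu> t \<epsilon> =
     {x. \<exists>S\<in>closed_balls. x \<in> S \<and> diameter S < \<epsilon> \<and> t * zeta_b c \<alpha> S < \<mu> S}"

text \<open>The density at a fixed scale. It increases with \<open>\<epsilon>\<close>, so its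
  infimum may be taken along any sequence of scales tending to 0.\<close>

definition upper_quotient :: "real \<Rightarrow> real \<Rightarrow> ('a::metric_space set \<Rightarrow> ennreal) \<Rightarrow> real \<Rightarrow> 'a \<Rightarrow> ennreal" where
  "upper_quotient c \<alpha> \<mu> \<epsilon> x =
     (SUP S\<in>{S \<in> admissible_balls \<mu> (zeta_b c \<alpha>). x \<in> S \<and> diameter S < \<epsilon>}. density_quotient \<mu> (zeta_b c \<alpha>) S)"

lemma spherical_density_eq: "spherical_density c \<alpha> \<mu> x = (INF \<epsilon>\<in>{0<..}. upper_quotient c \<alpha> \<mu> \<epsilon> x)"
  by (simp add: spherical_density_def upper_quotient_def)

lemma less_upper_quotient_iff:
  assumes "\<alpha> > 0" "c > 0" "t < top"
  shows "t < upper_quotient c \<alpha> \<mu> \<epsilon> x \<longleftrightarrow> x \<in> exceeding_points c \<alpha> \<mu> t \<epsilon>"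
  using admissible_density_quotient_gt_iff[OF assms, of _ \<mu>]
  unfolding upper_quotient_def exceeding_points_def less_SUP_iff by blast

lemma upper_quotient_mono: "\<epsilon> \<le> \<epsilon>' \<Longrightarrow> upper_quotient c \<alpha> \<mu> \<epsilon> x \<le> upper_quotient c \<alpha> \<mu> \<epsilon>' x"
  unfolding upper_quotient_def by (intro SUP_subset_mono) auto

lemma exceeding_points_mono: "\<epsilon> \<le> \<epsilon>' \<Longrightarrow> exceeding_points c \<alpha> \<mu> t \<epsilon> \<subseteq> exceeding_points c \<alpha> \<mu> t \<epsilon>'"
  unfolding exceeding_points_def by force

text \<open>Diametric regularity allows one to enlarge the radius of an exceeding ball slightly.\<close>

lemma exceeding_points_locally_open:
  fixes \<mu> :: "'a::metric_space set \<Rightarrow> ennreal"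
  assumes \<alpha>: "\<alpha> > 0" and c: "c > 0" and \<mu>: "federer_measure \<mu>" and t: "t < top"
    and cont: "\<And>y. y \<in> cball x0 (R + 1) \<Longrightarrow> continuous_on {0<..<\<delta>} (\<lambda>s. diameter (ball y s))"
    and \<epsilon>: "\<epsilon> \<le> \<delta>" "\<epsilon> \<le> 1"
  shows "open (exceeding_points c \<alpha> \<mu> t \<epsilon> \<inter> ball x0 R)"
proof -
  have ex: "\<exists>V. open V \<and> x \<in> V \<and> V \<subseteq> exceeding_points c \<alpha> \<mu> t \<epsilon>"
    if x: "x \<in> exceeding_points c \<alpha> \<mu> t \<epsilon>" "x \<in> ball x0 R" for x
  proof -
    obtain S where S: "S \<in> closed_balls" "x \<in> S" "diameter S < \<epsilon>" "t * zeta_b c \<alpha> S < \<mu> S"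
      using x(1) unfolding exceeding_points_def by blast
    obtain y r where yr: "S = cball y r" "0 < r" "r < \<epsilon>"
      using closed_ball_eq_cball_small_radius[OF S(1,3)] by blast
    \<comment> \<open>The radius is below 1, so the centre stays where continuity is
      assumed.\<close>
    have "dist x0 y \<le> R + 1"
      using dist_triangle[of x0 y x] x(2) S(2) yr \<epsilon> by (simp add: dist_commute)
    then have cy: "continuous_on {0<..<\<delta>} (\<lambda>s. diameter (ball y s))"
      by (intro cont) auto
    define h where "h s = diameter (ball y s)" for s
    have h_lim: "(h \<longlongrightarrow> h r) (at r)"
      using cy yr \<epsilon> unfolding h_def
      by (simp add: continuous_on_eq_continuous_at isCont_def)
    have h_nonneg: "h s \<ge> 0" for s
      by (simp add: h_def diameter_ge_0)
    \<comment> \<open>The open ball lies in \<open>S\<close>, so its diameter satisfies the same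
      strict inequalities, which continuity carries over to slightly larger radii.\<close>
    have hr: "h r \<le> diameter S"
      unfolding h_def yr(1) by (intro diameter_subset) auto
    obtain t' where t': "t = ennreal t'" "t' \<ge> 0"
      using t by (cases t) auto
    have "((\<lambda>s. ennreal (t' * (c * h s powr \<alpha>))) \<longlongrightarrow> ennreal (t' * (c * h r powr \<alpha>))) (at r)"
      using \<alpha> h_nonneg by (intro tendsto_intros tendsto_powr' h_lim) auto
    moreover have "ennreal (t' * (c * h r powr \<alpha>)) < \<mu> S"
    proof -
      have "ennreal (t' * (c * h r powr \<alpha>)) \<le> ennreal (t' * (c * diameter S powr \<alpha>))"
        using hr h_nonneg[of r] \<alpha> c t' by (intro ennreal_leI mult_left_mono powr_mono2) auto
      also have "\<dots> = t * zeta_b c \<alpha> S"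
        using c t' by (simp add: zeta_b_def ennreal_mult)
      finally show ?thesis
        using S(4) by simp
    qed
    ultimately have "eventually (\<lambda>s. ennreal (t' * (c * h s powr \<alpha>)) < \<mu> S) (at r)"
      by (rule order_tendstoD)
    moreover have "eventually (\<lambda>s. h s < \<epsilon>) (at r)"
      using hr S(3) by (intro order_tendstoD(2)[OF h_lim]) simp
    ultimately have "eventually (\<lambda>s. ennreal (t' * (c * h s powr \<alpha>)) < \<mu> S \<and> h s < \<epsilon>) (at r)"
      by (rule eventually_conj)
    then have "eventually (\<lambda>s. ennreal (t' * (c * h s powr \<alpha>)) < \<mu> S \<and> h s < \<epsilon>) (at_right r)"
      by (rule filter_leD[OF at_within_le_at])
    then obtain b where b: "b > r" "\<And>s. r < s \<Longrightarrow> s < b \<Longrightarrow> ennreal (t' * (c * h s powr \<alpha>)) < \<mu> S \<and> h s < \<epsilon>"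
      unfolding eventually_at_right_field by blast
    \<comment> \<open>Two radii are needed: \<open>cball y s2\<close> lies in
      \<open>ball y s1\<close>, whose diameter is controlled, and \<open>ball y s2\<close> is a
      neighbourhood of \<open>x\<close> because \<open>x\<close> has distance at most
      \<open>r\<close> from \<open>y\<close>.\<close>
    define s1 where "s1 = (r + b) / 2"
    define s2 where "s2 = (r + s1) / 2"
    have s: "r < s2" "s2 < s1" "s1 < b"
      using b(1) by (auto simp: s1_def s2_def)
    define T where "T = cball y s2"
    have T: "T \<in> closed_balls"
      using s yr by (simp add: T_def)
    have dT: "diameter T \<le> h s1"
      unfolding T_def h_def using s by (intro diameter_subset) auto
    have "diameter T < \<epsilon>"
      using dT b(2)[of s1] s by simp
    moreover have "t * zeta_b c \<alpha> T < \<mu> T"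
    proof -
      have "t * zeta_b c \<alpha> T \<le> ennreal t' * ennreal (c * h s1 powr \<alpha>)"
        unfolding t'(1) by (intro mult_left_mono zeta_b_le[OF \<alpha> c] T dT) simp
      also have "\<dots> = ennreal (t' * (c * h s1 powr \<alpha>))"
        using c t' by (simp add: ennreal_mult)
      also have "\<dots> < \<mu> S"
        using b(2)[of s1] s by simp
      also have "\<mu> S \<le> \<mu> T"
        unfolding T_def yr(1) using s by (intro outer_measure_mono[OF \<mu>]) auto
      finally show ?thesis .
    qed
    ultimately have "T \<subseteq> exceeding_points c \<alpha> \<mu> t \<epsilon>"
      using T by (auto simp: exceeding_points_def)
    moreover have "ball y s2 \<subseteq> T" "x \<in> ball y s2"
      using S(2) yr(1) s by (auto simp: T_def)
    ultimately show ?thesis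
      by (intro exI[of _ "ball y s2"]) auto
  qed
  show ?thesis
  proof (subst open_subopen, intro ballI)
    fix x assume x: "x \<in> exceeding_points c \<alpha> \<mu> t \<epsilon> \<inter> ball x0 R"
    then obtain V where "open V" "x \<in> V" "V \<subseteq> exceeding_points c \<alpha> \<mu> t \<epsilon>"
      using ex[of x] by blast
    with x show "\<exists>T. open T \<and> x \<in> T \<and> T \<subseteq> exceeding_points c \<alpha> \<mu> t \<epsilon> \<inter> ball x0 R"
      by (intro exI[of _ "V \<inter> ball x0 R"]) auto
  qed
qed

text \<open>Diametric regularity supplies one \<open>\<delta>\<close> for each bounded region, so
  measurability is proved on balls about a fixed point and then pieced together.\<close>

lemma borel_measurable_spherical_density:
  fixes \<mu> :: "'a::metric_space set \<Rightarrow> ennreal"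
  assumes reg: "diametrically_regular TYPE('a)"
    and \<alpha>: "\<alpha> > 0" and c: "c > 0" and \<mu>: "federer_measure \<mu>"
  shows "spherical_density c \<alpha> \<mu> \<in> borel_measurable borel"
proof -
  fix x0 :: 'a
  have loc: "spherical_density c \<alpha> \<mu> \<in> borel_measurable (restrict_space borel (ball x0 R))"
    if "R > 0" for R
  proof -
    obtain \<delta> where \<delta>: "\<delta> > 0" "\<And>y. y \<in> cball x0 (R + 1) \<Longrightarrow> continuous_on {0<..<\<delta>} (\<lambda>s. diameter (ball y s))"
      using reg[unfolded diametrically_regular_def, rule_format, of "R + 1" x0] \<open>R > 0\<close> by auto
    \<comment> \<open>These scales tend to 0, so they suffice for the infimum, and they respect the
      bounds under which exceeding sets are locally open.\<close>
    define e where "e n = min \<delta> (1 / real (Suc n))" for n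
    have e: "e n > 0" "e n \<le> \<delta>" "e n \<le> 1" for n
      using \<delta>(1) by (auto simp: e_def min_le_iff_disj)
    have "spherical_density c \<alpha> \<mu> x = (INF n. upper_quotient c \<alpha> \<mu> (e n) x)" for x
      unfolding spherical_density_eq
    proof (rule antisym)
      show "(INF n. upper_quotient c \<alpha> \<mu> (e n) x) \<le> (INF \<epsilon>\<in>{0<..}. upper_quotient c \<alpha> \<mu> \<epsilon> x)"
      proof (rule INF_greatest)
        fix \<epsilon> :: real assume "\<epsilon> \<in> {0<..}"
        then obtain n where "inverse (real (Suc n)) < \<epsilon>"
          using reals_Archimedean[of \<epsilon>] by auto
        then have "e n \<le> \<epsilon>"
          by (simp add: e_def min_le_iff_disj inverse_eq_divide)
        then show "(INF n. upper_quotient c \<alpha> \<mu> (e n) x) \<le> upper_quotient c \<alpha> \<mu> \<epsilon> x"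
          by (intro INF_lower2[of n] upper_quotient_mono) auto
      qed
      show "(INF \<epsilon>\<in>{0<..}. upper_quotient c \<alpha> \<mu> \<epsilon> x) \<le> (INF n. upper_quotient c \<alpha> \<mu> (e n) x)"
        using e(1) by (intro INF_greatest INF_lower) auto
    qed
    then have eq: "spherical_density c \<alpha> \<mu> = (\<lambda>x. INF n. upper_quotient c \<alpha> \<mu> (e n) x)"
      by (rule ext)
    have "upper_quotient c \<alpha> \<mu> (e n) \<in> borel_measurable (restrict_space borel (ball x0 R))" for n
    proof (rule borel_measurableI_greater)
      fix t :: ennreal
      show "{x \<in> space (restrict_space borel (ball x0 R)). t < upper_quotient c \<alpha> \<mu> (e n) x}
          \<in> sets (restrict_space borel (ball x0 R))"
      proof (cases "t < top")
        case True
        have "{x \<in> space (restrict_space borel (ball x0 R)). t < upper_quotient c \<alpha> \<mu> (e n) x}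
            = exceeding_points c \<alpha> \<mu> t (e n) \<inter> ball x0 R"
          by (auto simp: less_upper_quotient_iff[OF \<alpha> c True] space_restrict_space)
        moreover have "open (exceeding_points c \<alpha> \<mu> t (e n) \<inter> ball x0 R)"
          using \<delta>(2) e by (intro exceeding_points_locally_open[OF \<alpha> c \<mu> True]) auto
        ultimately show ?thesis
          by (simp add: sets_restrict_space_iff)
      qed (simp add: less_top[symmetric])
    qed
    then show ?thesis
      unfolding eq by (intro borel_measurable_INF) auto
  qed
  show ?thesis
  proof (rule measurable_piecewise_restrict)
    show "countable (range (\<lambda>n. ball x0 (real (Suc n))))"
      by simp
    show "space borel \<subseteq> \<Union> (range (\<lambda>n. ball x0 (real (Suc n))))"
    proof
      fix x :: 'a
      obtain n where "dist x0 x < real n"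
        using reals_Archimedean2 by blast
      then have "x \<in> ball x0 (real (Suc n))"
        by simp
      then show "x \<in> \<Union> (range (\<lambda>n. ball x0 (real (Suc n))))"
        by blast
    qed
  next
    fix \<Omega> assume "\<Omega> \<in> range (\<lambda>n. ball x0 (real (Suc n)))"
    then obtain n where n: "\<Omega> = ball x0 (real (Suc n))"
      by blast
    show "\<Omega> \<inter> space borel \<in> sets borel"
      by (simp add: n)
    show "spherical_density c \<alpha> \<mu> \<in> borel_measurable (restrict_space borel \<Omega>)"
      unfolding n by (rule loc) simp
  qed
qed

section \<open>Comparison of measures by means of the density\<close>

lemma borel_subset_caratheodory_sets_borel_regular:
  assumes "federer_measure \<mu>" "borel_regular \<mu>"
  shows "sets borel \<subseteq> caratheodory_sets \<mu>"
  using assms by (intro borel_subset_sigma_algebra sigma_algebra_caratheodory_sets) (auto simp: borel_regular_def)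

text \<open>Pushing forward along the identity replaces the Caratheodory sigma-algebra by the Borel
  one; the values of \<open>f\<close> survive once Borel sets are Caratheodory measurable.\<close>

definition borel_restriction :: "('a::topological_space set \<Rightarrow> ennreal) \<Rightarrow> 'a measure" where
  "borel_restriction f = distr (caratheodory_measure f) borel (\<lambda>x. x)"

lemma sets_borel_restriction [simp]: "sets (borel_restriction f) = sets borel"
  by (simp add: borel_restriction_def)

lemma emeasure_borel_restriction:
  assumes f: "federer_measure f" "sets borel \<subseteq> caratheodory_sets f" and E: "E \<in> sets borel"
  shows "emeasure (borel_restriction f) E = f E"
proof -
  have "(\<lambda>x. x) \<in> measurable (caratheodory_measure f) borel"
    using f by (auto simp: measurable_def sets_caratheodory_measure space_caratheodory_measure)
  then show ?thesis
    using f E emeasure_caratheodory_measure[of f E]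
    by (auto simp: borel_restriction_def emeasure_distr space_caratheodory_measure)
qed

text \<open>Continuity from below without measurability of the sets. Intersecting the tails of a
  sequence of Borel hulls gives increasing Borel sets \<open>F n\<close> between \<open>E n\<close>
  and its hull.\<close>

lemma borel_regular_UN_incseq_le:
  fixes E :: "nat \<Rightarrow> 'a::topological_space set"
  assumes \<mu>: "federer_measure \<mu>" and br: "borel_regular \<mu>"
    and "incseq E" and le: "\<And>n. \<mu> (E n) \<le> b"
  shows "\<mu> (\<Union>n. E n) \<le> b"
proof -
  note bor = borel_subset_caratheodory_sets_borel_regular[OF \<mu> br]
  have "\<forall>n. \<exists>H. H \<in> sets borel \<and> E n \<subseteq> H \<and> \<mu> H = \<mu> (E n)"
    using br unfolding borel_regular_def by blast
  then obtain H where H: "\<And>n. H n \<in> sets borel" "\<And>n. E n \<subseteq> H n" "\<And>n. \<mu> (H n) = \<mu> (E n)"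
    by metis
  define F where "F n = (\<Inter>k. H (n + k))" for n
  have F: "F n \<in> sets borel" for n
    unfolding F_def using H(1) by (intro sets.countable_INT) auto
  have "incseq F"
  proof (rule incseq_SucI)
    fix n show "F n \<subseteq> F (Suc n)"
    proof
      fix x assume "x \<in> F n"
      then have "x \<in> H (n + Suc k)" for k
        unfolding F_def by blast
      then show "x \<in> F (Suc n)"
        by (simp add: F_def)
    qed
  qed
  have E_F: "E n \<subseteq> F n" for n
  proof
    fix x assume "x \<in> E n"
    then have "x \<in> E (n + k)" for k
      using incseqD[OF \<open>incseq E\<close>, of n "n + k"] by auto
    then show "x \<in> F n"
      unfolding F_def using H(2) by blast
  qed
  have "\<mu> (\<Union>n. E n) \<le> \<mu> (\<Union>n. F n)"
    using E_F by (intro outer_measure_mono[OF \<mu>] UN_mono) auto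
  also have "\<dots> = emeasure (borel_restriction \<mu>) (\<Union>n. F n)"
    using F by (intro emeasure_borel_restriction[OF \<mu> bor, symmetric]) auto
  also have "\<dots> = (SUP n. emeasure (borel_restriction \<mu>) (F n))"
    using F \<open>incseq F\<close> by (intro SUP_emeasure_incseq[symmetric]) auto
  also have "\<dots> \<le> b"
  proof (rule SUP_least)
    fix n
    have "emeasure (borel_restriction \<mu>) (F n) = \<mu> (F n)"
      by (rule emeasure_borel_restriction[OF \<mu> bor F])
    also have "F n \<subseteq> H (n + 0)"
      unfolding F_def by blast
    then have "\<mu> (F n) \<le> \<mu> (H n)"
      by (intro outer_measure_mono[OF \<mu>]) simp
    finally show "emeasure (borel_restriction \<mu>) (F n) \<le> b"
      using H(3) le[of n] by simp
  qed
  finally show ?thesis .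
qed

text \<open>No closed ball of diameter below \<open>e n\<close> that meets \<open>D n\<close>
  exceeds the quotient \<open>t\<close>, so a covering at a smaller scale bounds
  \<open>\<mu> (D n)\<close>. The sets \<open>D n\<close> increase to \<open>E\<close> but may fail
  to be measurable, whence the passage through Borel hulls.\<close>

lemma measure_le_of_spherical_density_less:
  fixes \<mu> :: "'a::metric_space set \<Rightarrow> ennreal"
  assumes \<alpha>: "\<alpha> > 0" and c: "c > 0" and \<mu>: "federer_measure \<mu>" and br: "borel_regular \<mu>"
    and t: "t < top" and less: "\<And>x. x \<in> E \<Longrightarrow> spherical_density c \<alpha> \<mu> x < t"
  shows "\<mu> E \<le> t * spherical_hausdorff c \<alpha> E"
proof (cases "E = {}")
  case True
  then show ?thesis
    by (simp add: outer_measure_empty[OF \<mu>])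
next
  case False
  then have "t \<noteq> 0"
    using less by fastforce
  note S = federer_measure_spherical_hausdorff[OF \<alpha> c, where 'a = 'a]
  define e where "e n = 1 / real (Suc n)" for n
  have e: "e n > 0" for n
    by (simp add: e_def)
  define D where "D n = {x \<in> E. x \<notin> exceeding_points c \<alpha> \<mu> t (e n)}" for n
  have "incseq D"
  proof (rule incseq_SucI)
    fix n
    have "e (Suc n) \<le> e n"
      by (simp add: e_def field_simps)
    then show "D n \<subseteq> D (Suc n)"
      using exceeding_points_mono[of "e (Suc n)" "e n" c \<alpha> \<mu> t] by (auto simp: D_def)
  qed
  have "E \<subseteq> (\<Union>n. D n)"
  proof
    fix x assume "x \<in> E"
    with less[OF this] obtain \<epsilon> where \<epsilon>: "\<epsilon> > 0" "upper_quotient c \<alpha> \<mu> \<epsilon> x < t"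
      by (auto simp: spherical_density_eq INF_less_iff)
    then obtain n where "inverse (real (Suc n)) < \<epsilon>"
      using reals_Archimedean by blast
    then have "e n \<le> \<epsilon>"
      by (simp add: e_def inverse_eq_divide)
    then have "upper_quotient c \<alpha> \<mu> (e n) x < t"
      using \<epsilon>(2) by (rule le_less_trans[OF upper_quotient_mono])
    then have "x \<notin> exceeding_points c \<alpha> \<mu> t (e n)"
      by (simp add: less_upper_quotient_iff[OF \<alpha> c t, symmetric])
    then show "x \<in> (\<Union>n. D n)"
      using \<open>x \<in> E\<close> by (auto simp: D_def)
  qed
  then have "\<mu> E \<le> \<mu> (\<Union>n. D n)"
    by (rule outer_measure_mono[OF \<mu>])
  also have "\<dots> \<le> t * spherical_hausdorff c \<alpha> E"
  proof (rule borel_regular_UN_incseq_le[OF \<mu> br \<open>incseq D\<close>])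
    fix n
    \<comment> \<open>Dividing by \<open>t\<close> makes the estimate a lower bound for the infimum
      over coverings. The scale \<open>e n / 2\<close> turns the weak diameter bound into the strict
      one required.\<close>
    have "\<mu> (D n) / t \<le> zeta_b_delta c \<alpha> (e n / 2) (D n)"
      unfolding zeta_b_delta_def
    proof (rule Inf_greatest, elim CollectE exE conjE)
      fix z :: ennreal and C :: "nat \<Rightarrow> 'a set"
      assume z: "z = (\<Sum>j. zeta_b c \<alpha> (C j))" and C: "\<forall>j. C j \<in> closed_balls \<and> diameter (C j) \<le> e n / 2"
        and cov: "D n \<subseteq> (\<Union>j. C j)"
      have le: "\<mu> (D n \<inter> C j) \<le> t * zeta_b c \<alpha> (C j)" for j
      proof (cases "D n \<inter> C j = {}")
        case True
        then show ?thesis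
          by (simp add: outer_measure_empty[OF \<mu>])
      next
        case False
        then obtain x where x: "x \<in> C j" "x \<notin> exceeding_points c \<alpha> \<mu> t (e n)"
          by (auto simp: D_def)
        have "diameter (C j) < e n"
          using C[rule_format, of j] e[of n] by linarith
        with x C have "\<mu> (C j) \<le> t * zeta_b c \<alpha> (C j)"
          unfolding exceeding_points_def not_less[symmetric] by blast
        moreover have "\<mu> (D n \<inter> C j) \<le> \<mu> (C j)"
          by (intro outer_measure_mono[OF \<mu>]) auto
        ultimately show ?thesis
          by (rule order_trans[rotated])
      qed
      have "D n \<subseteq> (\<Union>j. D n \<inter> C j)"
        using cov by blast
      then have "\<mu> (D n) \<le> (\<Sum>j. \<mu> (D n \<inter> C j))"
        by (rule order_trans[OF outer_measure_mono[OF \<mu>] outer_measure_UN_le[OF \<mu>]])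
      also have "\<dots> \<le> (\<Sum>j. t * zeta_b c \<alpha> (C j))"
        using le by (intro suminf_le) auto
      also have "\<dots> = z * t"
        by (simp add: z mult.commute)
      finally show "\<mu> (D n) / t \<le> z"
        by (simp add: ennreal_divide_le_iff[OF \<open>t \<noteq> 0\<close> t])
    qed
    also have "\<dots> \<le> spherical_hausdorff c \<alpha> (D n)"
      using e[of n] by (intro zeta_b_delta_le_spherical_hausdorff[OF \<alpha> c]) simp
    also have "\<dots> \<le> spherical_hausdorff c \<alpha> E"
      by (rule outer_measure_mono[OF S]) (auto simp: D_def)
    finally show "\<mu> (D n) \<le> t * spherical_hausdorff c \<alpha> E"
      by (simp add: ennreal_divide_le_iff[OF \<open>t \<noteq> 0\<close> t] mult.commute)
  qed
  finally show ?thesis .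
qed

subsection \<open>A Vitali covering argument\<close>

text \<open>Zorn's lemma is applied to disjoint subfamilies \<open>H\<close> such that every member
  of \<open>F\<close> meeting \<open>H\<close> meets an element of at least half its size. A maximal
  one misses no member of \<open>F\<close>, since a nearly largest missed set could be
  added.\<close>

lemma vitali_disjoint_subfamily:
  fixes F :: "'a set set" and d :: "'a set \<Rightarrow> real"
  assumes ne: "{} \<notin> F" and d: "\<And>S. S \<in> F \<Longrightarrow> 0 \<le> d S" "\<And>S. S \<in> F \<Longrightarrow> d S \<le> b"
  obtains G where "G \<subseteq> F" "disjoint G" "\<And>S. S \<in> F \<Longrightarrow> \<exists>T\<in>G. S \<inter> T \<noteq> {} \<and> d S \<le> 2 * d T"
proof -
  define \<Omega> where "\<Omega> = {H. H \<subseteq> F \<and> disjoint H \<and>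
    (\<forall>S\<in>F. (\<exists>T\<in>H. S \<inter> T \<noteq> {}) \<longrightarrow> (\<exists>T\<in>H. S \<inter> T \<noteq> {} \<and> d S \<le> 2 * d T))}"
  have "\<exists>M\<in>\<Omega>. \<forall>X\<in>\<Omega>. M \<subseteq> X \<longrightarrow> X = M"
  proof (rule subset_Zorn')
    fix C assume C: "subset.chain \<Omega> C"
    then have sub: "C \<subseteq> \<Omega>"
      by (simp add: subset_chain_def)
    have "disjoint (\<Union>C)"
    proof (rule pairwiseI)
      fix S T assume "S \<in> \<Union>C" "T \<in> \<Union>C" "S \<noteq> T"
      then obtain X Y where XY: "X \<in> C" "Y \<in> C" "S \<in> X" "T \<in> Y"
        by blast
      then have "X \<subseteq> Y \<or> Y \<subseteq> X"
        using C by (simp add: subset_chain_def)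
      then obtain Z where "Z \<in> C" "S \<in> Z" "T \<in> Z"
        using XY by blast
      moreover from this(1) have "disjoint Z"
        using sub by (auto simp: \<Omega>_def)
      ultimately show "disjnt S T"
        using \<open>S \<noteq> T\<close> by (simp add: pairwise_def)
    qed
    moreover have "\<Union>C \<subseteq> F"
      using sub by (auto simp: \<Omega>_def)
    moreover have "\<exists>T\<in>\<Union>C. S \<inter> T \<noteq> {} \<and> d S \<le> 2 * d T" if S: "S \<in> F" "\<exists>T\<in>\<Union>C. S \<inter> T \<noteq> {}" for S
    proof -
      obtain H T where H: "H \<in> C" "T \<in> H" "S \<inter> T \<noteq> {}"
        using S(2) by blast
      then have "\<exists>T\<in>H. S \<inter> T \<noteq> {} \<and> d S \<le> 2 * d T"
        using sub S(1) unfolding \<Omega>_def by blast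
      then show ?thesis
        using H(1) by blast
    qed
    ultimately show "\<Union>C \<in> \<Omega>"
      unfolding \<Omega>_def by blast
  qed
  then obtain M where M: "M \<in> \<Omega>" "\<And>X. X \<in> \<Omega> \<Longrightarrow> M \<subseteq> X \<Longrightarrow> X = M"
    by blast
  have MF: "M \<subseteq> F" "disjoint M"
    and M3: "\<And>S. S \<in> F \<Longrightarrow> \<exists>T\<in>M. S \<inter> T \<noteq> {} \<Longrightarrow> \<exists>T\<in>M. S \<inter> T \<noteq> {} \<and> d S \<le> 2 * d T"
    using M(1) unfolding \<Omega>_def by blast+
  define N where "N = {S \<in> F. \<forall>T\<in>M. S \<inter> T = {}}"
  have "N = {}"
  proof (rule ccontr)
    assume "N \<noteq> {}"
    have bdd: "bdd_above (d ` N)"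
      using d(2) by (auto simp: N_def intro!: bdd_aboveI2)
    \<comment> \<open>The supremum over missed sets need not be attained; this is the origin of the
      factor 2. If it is 0, any missed set will do.\<close>
    have "\<exists>S0\<in>N. \<forall>S\<in>N. d S \<le> 2 * d S0"
    proof (cases "Sup (d ` N) > 0")
      case True
      then have "Sup (d ` N) / 2 < Sup (d ` N)"
        by simp
      then obtain S0 where "S0 \<in> N" "Sup (d ` N) / 2 < d S0"
        using less_cSupE[of "Sup (d ` N) / 2" "d ` N"] \<open>N \<noteq> {}\<close> by blast
      moreover have "d S \<le> Sup (d ` N)" if "S \<in> N" for S
        using that bdd by (intro cSup_upper) auto
      ultimately show ?thesis
        by (intro bexI[of _ S0]) force+
    next
      case False
      obtain S0 where "S0 \<in> N"
        using \<open>N \<noteq> {}\<close> by blast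
      moreover have "d S \<le> 0" if "S \<in> N" for S
        using that bdd False cSup_upper[of "d S" "d ` N"] by force
      moreover have "d S0 \<ge> 0"
        using \<open>S0 \<in> N\<close> d(1) by (auto simp: N_def)
      ultimately show ?thesis
        by (intro bexI[of _ S0]) force+
    qed
    then obtain S0 where S0: "S0 \<in> N" "\<And>S. S \<in> N \<Longrightarrow> d S \<le> 2 * d S0"
      by blast
    have "disjoint (insert S0 M)"
      using MF(2) S0(1) by (auto simp: pairwise_insert disjnt_def N_def)
    moreover have "insert S0 M \<subseteq> F"
      using MF(1) S0(1) by (auto simp: N_def)
    moreover have "\<exists>T\<in>insert S0 M. S \<inter> T \<noteq> {} \<and> d S \<le> 2 * d T"
      if S: "S \<in> F" "\<exists>T\<in>insert S0 M. S \<inter> T \<noteq> {}" for S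
    proof (cases "S \<in> N")
      case True
      then show ?thesis
        using S S0(2) unfolding N_def by blast
    next
      case False
      then show ?thesis
        using S(1) M3[OF S(1)] unfolding N_def by blast
    qed
    ultimately have "insert S0 M \<in> \<Omega>"
      unfolding \<Omega>_def by blast
    then have "insert S0 M = M"
      by (rule M(2)) blast
    then have "S0 \<in> M"
      by blast
    \<comment> \<open>As an element of \<open>N\<close>, \<open>S0\<close> is disjoint from every
      member of \<open>M\<close>, hence from itself.\<close>
    then have "S0 = {}"
      using S0(1) unfolding N_def by blast
    then show False
      using S0(1) ne by (simp add: N_def)
  qed
  show ?thesis
  proof (rule that[OF MF])
    fix S assume "S \<in> F"
    moreover have "\<exists>T\<in>M. S \<inter> T \<noteq> {}"
      using \<open>N = {}\<close> \<open>S \<in> F\<close> unfolding N_def by blast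
    ultimately show "\<exists>T\<in>M. S \<inter> T \<noteq> {} \<and> d S \<le> 2 * d T"
      by (rule M3)
  qed
qed

text \<open>Radii may be much larger than diameters, so the enlargement has radius
  \<open>3 * diameter T\<close>. For diameter 0 this is no admissible radius, but then
  \<open>S\<close> is a single point of \<open>T\<close>.\<close>

lemma ex_enlarged_closed_ball:
  fixes T :: "'a::metric_space set"
  assumes T: "T \<in> closed_balls"
  shows "\<exists>B\<in>closed_balls. diameter B \<le> 6 * diameter T \<and>
    (\<forall>S\<in>closed_balls. S \<inter> T \<noteq> {} \<and> diameter S \<le> 2 * diameter T \<longrightarrow> S \<subseteq> B)"
proof (cases "diameter T = 0")
  case True
  have "S \<subseteq> T" if S: "S \<in> closed_balls" "S \<inter> T \<noteq> {}" "diameter S \<le> 2 * diameter T" for S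
  proof
    fix x assume "x \<in> S"
    obtain z where z: "z \<in> S" "z \<in> T"
      using S(2) by blast
    have "dist x z \<le> 0"
      using dist_le_diameter_closed_ball[OF S(1) \<open>x \<in> S\<close> z(1)] S(3) True by linarith
    then have "x = z"
      by (simp only: dist_le_zero_iff)
    with z show "x \<in> T"
      by simp
  qed
  then show ?thesis
    using T True by (intro bexI[of _ T]) auto
next
  case False
  with closed_balls_props[OF T] have pos: "diameter T > 0"
    by simp
  obtain y r where y: "T = cball y r" "r > 0"
    using T by (auto simp: closed_balls_def)
  have "S \<subseteq> cball y (3 * diameter T)"
    if S: "S \<in> closed_balls" "S \<inter> T \<noteq> {}" "diameter S \<le> 2 * diameter T" for S
  proof
    fix x assume "x \<in> S"
    obtain z where z: "z \<in> S" "z \<in> T"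
      using S(2) by blast
    have "y \<in> T"
      using y by simp
    have "dist y x \<le> dist y z + dist z x"
      by (rule dist_triangle)
    also have "\<dots> \<le> diameter T + diameter S"
      using dist_le_diameter_closed_ball[OF T \<open>y \<in> T\<close> z(2)]
        dist_le_diameter_closed_ball[OF S(1) z(1) \<open>x \<in> S\<close>] by simp
    finally show "x \<in> cball y (3 * diameter T)"
      using S(3) by simp
  qed
  then show ?thesis
    using pos diameter_cball_le[of "3 * diameter T" y]
    by (intro bexI[of _ "cball y (3 * diameter T)"]) auto
qed

text \<open>Finite subfamilies have total measure at most that of \<open>U\<close>, so the positive
  numbers \<open>measure M S\<close> are summable over \<open>G\<close>.\<close>

lemma countable_disjoint_positive_measure:
  assumes G: "disjoint G" "G \<subseteq> sets M" "\<And>S. S \<in> G \<Longrightarrow> S \<subseteq> U"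
    and U: "U \<in> sets M" "emeasure M U < top" and pos: "\<And>S. S \<in> G \<Longrightarrow> emeasure M S > 0"
  shows "countable G"
proof -
  have fin: "emeasure M S = ennreal (measure M S)" if "S \<in> G" for S
    using emeasure_mono[OF G(3)[OF that] U(1)] U(2) by (intro emeasure_eq_ennreal_measure) auto
  have "sum (measure M) H \<le> measure M U" if H: "finite H" "H \<subseteq> G" for H
  proof -
    have "ennreal (sum (measure M) H) = (\<Sum>S\<in>H. emeasure M S)"
    proof -
      have "(\<Sum>S\<in>H. emeasure M S) = (\<Sum>S\<in>H. ennreal (measure M S))"
        using H fin by (intro sum.cong) auto
      then show ?thesis
        by (simp add: sum_ennreal)
    qed
    also have "\<dots> = emeasure M (\<Union>S\<in>H. S)"
      using H G(1,2) by (intro sum_emeasure) (auto simp: disjoint_family_on_def pairwise_def disjnt_def)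
    also have "\<dots> \<le> emeasure M U"
      using H G U by (intro emeasure_mono) auto
    also have "\<dots> = ennreal (measure M U)"
      using U by (intro emeasure_eq_ennreal_measure) auto
    finally show ?thesis
      by (simp add: ennreal_le_iff)
  qed
  then have "measure M summable_on G"
    by (intro nonneg_bdd_above_summable_on bdd_aboveI2[of _ _ "measure M U"]) auto
  then have "countable {S \<in> G. measure M S \<noteq> 0}"
    by (rule summable_countable_real)
  moreover have "{S \<in> G. measure M S \<noteq> 0} = G"
    using pos fin by fastforce
  ultimately show ?thesis
    by simp
qed

text \<open>In a disjoint Vitali subfamily of balls exceeding \<open>t\<close>, the sum of
  \<open>t * zeta_b\<close> is at most \<open>\<mu> U\<close>. The first \<open>n\<close> balls and
  enlargements of the others cover \<open>E\<close>; the enlargement factor multiplies only the tail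
  of a convergent series and disappears in the limit.\<close>

lemma spherical_hausdorff_le_of_spherical_density_greater:
  fixes \<mu> :: "'a::metric_space set \<Rightarrow> ennreal"
  assumes \<alpha>: "\<alpha> > 0" and c: "c > 0" and \<mu>: "federer_measure \<mu>" and bor: "sets borel \<subseteq> caratheodory_sets \<mu>"
    and t: "t < top" and greater: "\<And>x. x \<in> E \<Longrightarrow> t < spherical_density c \<alpha> \<mu> x"
    and U: "open U" "E \<subseteq> U"
  shows "t * spherical_hausdorff c \<alpha> E \<le> \<mu> U"
proof (cases "t = 0 \<or> \<mu> U = top")
  case True
  then show ?thesis
    by auto
next
  case False
  then have "t \<noteq> 0" and fin: "\<mu> U < top"
    by (auto simp: less_top)
  define N where "N = borel_restriction \<mu>"
  have sN: "sets N = sets borel"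
    by (simp add: N_def)
  have N: "emeasure N X = \<mu> X" if "X \<in> sets borel" for X
    unfolding N_def by (rule emeasure_borel_restriction[OF \<mu> bor that])
  have main: "t * zeta_b_delta c \<alpha> (6 * \<delta>) E \<le> \<mu> U" if \<delta>: "\<delta> > 0" for \<delta>
  proof -
    define F where "F = {S \<in> closed_balls. S \<subseteq> U \<and> diameter S < \<delta> \<and> t * zeta_b c \<alpha> S < \<mu> S}"
    have F: "S \<in> closed_balls" "S \<subseteq> U" "diameter S < \<delta>" "t * zeta_b c \<alpha> S < \<mu> S" "S \<in> sets borel" if "S \<in> F" for S
      using that closed_balls_props(2)[of S] by (auto simp: F_def)
    \<comment> \<open>The open set \<open>V\<close> will be the complement of finitely many selected
      balls.\<close>
    have fine: "\<exists>S\<in>F. x \<in> S \<and> S \<subseteq> V" if x: "x \<in> E" "open V" "x \<in> V" for x V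
    proof -
      have "open (U \<inter> V)" "x \<in> U \<inter> V"
        using U x by auto
      then obtain e where e: "e > 0" "ball x e \<subseteq> U \<inter> V"
        using open_contains_ball by blast
      have "t < (INF \<epsilon>\<in>{0<..}. upper_quotient c \<alpha> \<mu> \<epsilon> x)"
        using greater[OF x(1)] by (simp only: spherical_density_eq)
      then have "t < upper_quotient c \<alpha> \<mu> (min e \<delta>) x"
        by (rule less_INF_D) (use e(1) \<delta> in simp)
      then obtain S where S: "S \<in> closed_balls" "x \<in> S" "diameter S < min e \<delta>" "t * zeta_b c \<alpha> S < \<mu> S"
        unfolding less_upper_quotient_iff[OF \<alpha> c t] exceeding_points_def by blast
      have "S \<subseteq> ball x e"
      proof
        fix z assume "z \<in> S"
        then show "z \<in> ball x e"
          using dist_le_diameter_closed_ball[OF S(1,2)] S(3) by force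
      qed
      then show ?thesis
        using S e(2) by (intro bexI[of _ S]) (auto simp: F_def)
    qed
    obtain G where G: "G \<subseteq> F" "disjoint G"
        "\<And>S. S \<in> F \<Longrightarrow> \<exists>T\<in>G. S \<inter> T \<noteq> {} \<and> diameter S \<le> 2 * diameter T"
    proof (rule vitali_disjoint_subfamily[of F diameter \<delta>])
      show "{} \<notin> F"
        using F(1) closed_balls_props(3) by blast
      show "0 \<le> diameter S" "diameter S \<le> \<delta>" if "S \<in> F" for S
        using F[OF that] closed_balls_props(4) by auto
    qed (rule that; blast)
    have "countable G"
    proof (rule countable_disjoint_positive_measure[OF G(2), of N U])
      show "G \<subseteq> sets N" "\<And>S. S \<in> G \<Longrightarrow> S \<subseteq> U" "U \<in> sets N" "emeasure N U < top"
        using G(1) F U fin by (auto simp: sN N)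
      fix S assume "S \<in> G"
      then have "S \<in> F" using G(1) by blast
      then show "emeasure N S > 0"
        using F(4)[of S] F(5)[of S] by (simp add: N) (metis not_gr_zero not_less_zero)
    qed
    \<comment> \<open>\<open>G\<close> may be finite, so it is enumerated over a subset
      \<open>I\<close> of the naturals; \<open>w\<close> and \<open>m\<close> are 0 and empty
      elsewhere.\<close>
    define I where "I = to_nat_on G ` G"
    define g where "g = from_nat_into G"
    have g: "g (to_nat_on G S) = S" if "S \<in> G" for S
      using that \<open>countable G\<close> by (simp add: g_def)
    have gI: "g j \<in> G" if "j \<in> I" for j
      using that g by (auto simp: I_def)
    have g_inj: "i = j" if "i \<in> I" "j \<in> I" "g i = g j" for i j
      using that g by (auto simp: I_def)
    have gF: "g j \<in> F" if "j \<in> I" for j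
      using gI[OF that] G(1) by blast
    define w where "w j = (if j \<in> I then zeta_b c \<alpha> (g j) else 0)" for j
    define m where "m j = (if j \<in> I then g j else {})" for j
    have w_sum: "t * (\<Sum>j. w j) \<le> \<mu> U"
    proof -
      have "t * (\<Sum>j. w j) = (\<Sum>j. t * w j)"
        by simp
      also have "\<dots> \<le> (\<Sum>j. emeasure N (m j))"
        using F(4,5)[OF gF] by (intro suminf_le) (auto simp: w_def m_def N intro: less_imp_le)
      also have "\<dots> = emeasure N (\<Union>j. m j)"
      proof (rule suminf_emeasure)
        show "range m \<subseteq> sets N"
          using F(5)[OF gF] by (auto simp: m_def sN)
        show "disjoint_family m"
          unfolding disjoint_family_on_def
        proof (intro ballI impI)
          fix i j :: nat assume "i \<noteq> j"
          show "m i \<inter> m j = {}"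
          proof (cases "i \<in> I \<and> j \<in> I")
            case True
            then have "g i \<noteq> g j"
              using g_inj \<open>i \<noteq> j\<close> by blast
            then have "disjnt (g i) (g j)"
              using True gI G(2) by (auto simp: pairwise_def)
            then show ?thesis
              using True by (simp add: m_def disjnt_def)
          qed (auto simp: m_def)
        qed
      qed
      also have "\<dots> \<le> emeasure N U"
        using F(2)[OF gF] U by (intro emeasure_mono) (auto simp: m_def sN split: if_splits)
      also have "\<dots> = \<mu> U"
        using U by (intro N) auto
      finally show ?thesis .
    qed
    have w_fin: "(\<Sum>j. w j) \<noteq> top"
    proof
      assume "(\<Sum>j. w j) = top"
      with w_sum fin \<open>t \<noteq> 0\<close> show False
        by (simp add: ennreal_mult_top top_unique)
    qed
    have "\<exists>B\<in>closed_balls. diameter B \<le> 6 * diameter (g j) \<and>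
        (\<forall>S\<in>closed_balls. S \<inter> g j \<noteq> {} \<and> diameter S \<le> 2 * diameter (g j) \<longrightarrow> S \<subseteq> B)" if "j \<in> I" for j
      using F(1)[OF gF[OF that]] by (rule ex_enlarged_closed_ball)
    then obtain B where B: "\<And>j. j \<in> I \<Longrightarrow> B j \<in> closed_balls" "\<And>j. j \<in> I \<Longrightarrow> diameter (B j) \<le> 6 * diameter (g j)"
        "\<And>j S. j \<in> I \<Longrightarrow> S \<in> closed_balls \<Longrightarrow> S \<inter> g j \<noteq> {} \<Longrightarrow> diameter S \<le> 2 * diameter (g j) \<Longrightarrow> S \<subseteq> B j"
      by metis
    define K where "K = ennreal (6 powr \<alpha>)"
    have zB: "zeta_b c \<alpha> (B j) \<le> K * zeta_b c \<alpha> (g j)" if j: "j \<in> I" for j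
    proof -
      have "zeta_b c \<alpha> (B j) \<le> ennreal (c * (6 * diameter (g j)) powr \<alpha>)"
        by (rule zeta_b_le[OF \<alpha> c B(1,2)[OF j]])
      also have "\<dots> = ennreal (6 powr \<alpha> * (c * diameter (g j) powr \<alpha>))"
        using closed_balls_props(4)[OF F(1)[OF gF[OF j]]] by (simp add: powr_mult mult_ac)
      also have "\<dots> = K * zeta_b c \<alpha> (g j)"
        unfolding K_def zeta_b_def using c by (intro ennreal_mult) auto
      finally show ?thesis .
    qed
    have Z: "zeta_b_delta c \<alpha> (6 * \<delta>) E \<le> (\<Sum>j. w j) + K * (\<Sum>j. w (j + n))" for n
    proof -
      define f where "f j = (if j < n then g j else B j)" for j
      have cov: "E \<subseteq> (\<Union>j\<in>I. f j)"
      proof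
        fix x assume x: "x \<in> E"
        define C where "C = (\<Union>j\<in>I \<inter> {..<n}. g j)"
        show "x \<in> (\<Union>j\<in>I. f j)"
        proof (cases "x \<in> C")
          case True
          then show ?thesis
            unfolding C_def f_def by auto
        next
          case False
          \<comment> \<open>Off the first \<open>n\<close> balls some ball of \<open>F\<close>
            around \<open>x\<close> misses them all; the selected ball that it meets therefore has
            index at least \<open>n\<close>, and its enlargement contains \<open>x\<close>.\<close>
          have "closed C"
            unfolding C_def using F(1)[OF gF] closed_balls_props(2) by (intro closed_UN) auto
          then obtain S where S: "S \<in> F" "x \<in> S" "S \<subseteq> - C"
            using fine[of x "- C"] x False by auto
          obtain T where T: "T \<in> G" "S \<inter> T \<noteq> {}" "diameter S \<le> 2 * diameter T"
            using G(3)[OF S(1)] by blast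
          define j where "j = to_nat_on G T"
          have j: "j \<in> I" "g j = T"
            using T(1) g by (auto simp: j_def I_def)
          have "\<not> j < n"
          proof
            assume "j < n"
            then have "T \<subseteq> C"
              using j unfolding C_def by blast
            then show False
              using S(3) T(2) by blast
          qed
          moreover have "S \<subseteq> B j"
            using T j by (intro B(3) F(1)[OF S(1)]) auto
          ultimately show ?thesis
            using S(2) j(1) by (intro UN_I[of j]) (auto simp: f_def)
        qed
      qed
      define h where "h j = (if j \<in> I then zeta_b c \<alpha> (f j) else 0)" for j
      have fp: "f j \<in> closed_balls" "diameter (f j) \<le> 6 * \<delta>" if j: "j \<in> I" for j
        using B(1,2)[OF j] F(1,3)[OF gF[OF j]] closed_balls_props(4)[OF F(1)[OF gF[OF j]]] by (auto simp: f_def)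
      have "zeta_b_delta c \<alpha> (6 * \<delta>) E \<le> (\<Sum>j. h j)"
        unfolding h_def using \<delta> by (intro zeta_b_delta_le_suminf[OF \<alpha> c] fp cov) auto
      also have "\<dots> = (\<Sum>j. h (j + n)) + (\<Sum>j<n. h j)"
        by (rule suminf_offset) auto
      also have "\<dots> \<le> (\<Sum>j. K * w (j + n)) + (\<Sum>j<n. w j)"
        using zB by (intro add_mono suminf_le sum_mono) (auto simp: h_def w_def f_def)
      also have "\<dots> \<le> K * (\<Sum>j. w (j + n)) + (\<Sum>j. w j)"
        by (intro add_mono sum_le_suminf) auto
      finally show ?thesis
        by (simp add: add.commute)
    qed
    have "(\<lambda>n. (\<Sum>j. w j) + K * (\<Sum>j. w (j + n))) \<longlonglongrightarrow> (\<Sum>j. w j) + K * 0"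
      using ennreal_suminf_tail_tendsto_0[OF w_fin]
      by (intro tendsto_add tendsto_const ennreal_tendsto_cmult) (auto simp: K_def)
    then have "zeta_b_delta c \<alpha> (6 * \<delta>) E \<le> (\<Sum>j. w j) + K * 0"
      by (rule LIMSEQ_le_const) (use Z in blast)
    then have "t * zeta_b_delta c \<alpha> (6 * \<delta>) E \<le> t * (\<Sum>j. w j)"
      by (intro mult_left_mono) auto
    then show ?thesis
      using w_sum by (rule order_trans)
  qed
  have "t * spherical_hausdorff c \<alpha> E = (SUP \<delta>\<in>{0<..}. t * zeta_b_delta c \<alpha> \<delta> E)"
    unfolding spherical_hausdorff_def by (rule SUP_mult_left_ennreal)
  also have "\<dots> \<le> \<mu> U"
  proof (rule SUP_least)
    fix \<delta> :: real assume "\<delta> \<in> {0<..}"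
    then show "t * zeta_b_delta c \<alpha> \<delta> E \<le> \<mu> U"
      using main[of "\<delta> / 6"] by simp
  qed
  finally show ?thesis .
qed

section \<open>The area formula\<close>

theorem theorem5:
  fixes \<mu> :: "'a::metric_space set \<Rightarrow> ennreal"
    and \<alpha> c\<^sub>\<alpha> :: real
    and A B :: "'a set"
  assumes "diametrically_regular TYPE('a)"
    and "\<alpha> > 0" and "c\<^sub>\<alpha> > 0"
    and "federer_measure \<mu>" and "borel_regular \<mu>"
    and "\<exists>\<U>. countable \<U> \<and> (\<forall>U\<in>\<U>. open U \<and> \<mu> U < \<infinity>) \<and> \<Union>\<U> = UNIV"
    and "A \<in> sets borel" and "B \<in> sets borel" and "B \<subseteq> A"
    and "covers_finely (admissible_balls \<mu> (zeta_b c\<^sub>\<alpha> \<alpha>)) A"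
  shows "spherical_density c\<^sub>\<alpha> \<alpha> \<mu> \<in> borel_measurable (restrict_space borel A) \<and>
    (spherical_hausdorff c\<^sub>\<alpha> \<alpha> A < \<infinity> \<longrightarrow>
     outer_absolutely_continuous (outer_restrict \<mu> A)
       (outer_restrict (spherical_hausdorff c\<^sub>\<alpha> \<alpha>) A) \<longrightarrow>
     \<mu> B = (\<integral>\<^sup>+x\<in>B. spherical_density c\<^sub>\<alpha> \<alpha> \<mu> x
               \<partial>caratheodory_measure (spherical_hausdorff c\<^sub>\<alpha> \<alpha>)))"
proof (intro conjI impI)
  note \<alpha> = assms(2) and c = assms(3) and \<mu> = assms(4) and br = assms(5)
  define \<theta> where "\<theta> = spherical_density c\<^sub>\<alpha> \<alpha> \<mu>"
  define \<S> where "\<S> = (spherical_hausdorff c\<^sub>\<alpha> \<alpha> :: 'a set \<Rightarrow> ennreal)"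
  have \<theta>: "\<theta> \<in> borel_measurable borel"
    unfolding \<theta>_def by (rule borel_measurable_spherical_density[OF assms(1) \<alpha> c \<mu>])
  then show "spherical_density c\<^sub>\<alpha> \<alpha> \<mu> \<in> borel_measurable (restrict_space borel A)"
    unfolding \<theta>_def by (rule measurable_restrict_space1)
  assume S_fin: "spherical_hausdorff c\<^sub>\<alpha> \<alpha> A < \<infinity>"
    and ac: "outer_absolutely_continuous (outer_restrict \<mu> A) (outer_restrict (spherical_hausdorff c\<^sub>\<alpha> \<alpha>) A)"

  \<comment> \<open>Borel measures attached to the two outer measures\<close>
  have S: "federer_measure \<S>"
    unfolding \<S>_def by (rule federer_measure_spherical_hausdorff[OF \<alpha> c])
  have bor_S: "sets borel \<subseteq> caratheodory_sets \<S>"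
    using S metric_outer_measure_spherical_hausdorff[OF \<alpha> c] unfolding \<S>_def
    by (rule borel_subset_caratheodory_sets_metric)
  note bor_\<mu> = borel_subset_caratheodory_sets_borel_regular[OF \<mu> br]
  define M where "M = borel_restriction \<mu>"
  define N where "N = borel_restriction \<S>"
  \<comment> \<open>The indefinite integral of the density; the formula becomes equality of
    \<open>M\<close> and \<open>D\<close> on \<open>B\<close>.\<close>
  define D where "D = density N \<theta>"
  have sets [simp]: "sets M = sets borel" "sets N = sets borel" "sets D = sets borel"
    by (simp_all add: M_def N_def D_def)
  have M: "emeasure M X = \<mu> X" if "X \<in> sets borel" for X
    unfolding M_def by (rule emeasure_borel_restriction[OF \<mu> bor_\<mu> that])
  have N: "emeasure N X = \<S> X" if "X \<in> sets borel" for X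
    unfolding N_def by (rule emeasure_borel_restriction[OF S bor_S that])
  have \<theta>_N: "\<theta> \<in> borel_measurable N"
    using \<theta> by (simp cong: measurable_cong_sets)
  have D: "emeasure D X = (\<integral>\<^sup>+x. \<theta> x * indicator X x \<partial>N)" if "X \<in> sets borel" for X
    unfolding D_def using \<theta>_N that by (intro emeasure_density) auto
  obtain V :: "nat \<Rightarrow> 'a set" where V: "\<And>i. open (V i)" "\<And>i. \<mu> (V i) < top" "(\<Union>i. V i) = UNIV"
  proof -
    obtain \<U> where \<U>: "countable \<U>" "\<forall>U\<in>\<U>. open U \<and> \<mu> U < \<infinity>" "\<Union>\<U> = UNIV"
      using assms(6) by (elim exE conjE) (rule that)
    \<comment> \<open>The space is inhabited, so the covering is nonempty and can be enumerated,
      with repetitions if it is finite.\<close>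
    have "\<U> \<noteq> {}"
    proof
      assume "\<U> = {}"
      with \<U>(3) show False
        by simp
    qed
    show ?thesis
    proof (rule that)
      show "open (from_nat_into \<U> i)" "\<mu> (from_nat_into \<U> i) < top" for i
        using \<U>(2) from_nat_into[OF \<open>\<U> \<noteq> {}\<close>, of i] by auto
      show "(\<Union>i. from_nat_into \<U> i) = UNIV"
        by (simp add: range_from_nat_into[OF \<open>\<U> \<noteq> {}\<close> \<U>(1)] \<U>(3))
    qed
  qed

  \<comment> \<open>Comparison of the two measures on level sets of the density\<close>
  have lower: "t * \<S> E \<le> \<mu> E" if t: "t < top" and E: "E \<in> sets borel" "\<And>x. x \<in> E \<Longrightarrow> t < \<theta> x" for t E
  proof (rule ennreal_le_epsilon)
    fix e :: real assume "e > 0"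
    have "emeasure M (V i) < top" for i
      using V(1,2)[of i] by (simp add: M)
    then obtain U where U: "open U" "E \<subseteq> U" "emeasure M U \<le> emeasure M E + ennreal e"
      using borel_measure_outer_regular[of M V E e] V(1,3) E(1) \<open>e > 0\<close> by (metis sets(1))
    have "t * \<S> E \<le> \<mu> U"
      unfolding \<S>_def using E(2) unfolding \<theta>_def
      by (rule spherical_hausdorff_le_of_spherical_density_greater[OF \<alpha> c \<mu> bor_\<mu> t _ U(1,2)])
    with U E(1) show "t * \<S> E \<le> \<mu> E + ennreal e"
      by (simp add: M)
  qed
  have upper: "\<mu> E \<le> t * \<S> E" if t: "t < top" and E: "\<And>x. x \<in> E \<Longrightarrow> \<theta> x < t" for t E
    unfolding \<S>_def using E unfolding \<theta>_def
    by (rule measure_le_of_spherical_density_less[OF \<alpha> c \<mu> br t])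

  have B: "B \<in> sets borel" "B \<subseteq> A"
    by fact+
  define B1 where "B1 = B \<inter> {x. \<theta> x < top}"
  define B2 where "B2 = B \<inter> {x. \<theta> x = top}"
  have B12: "B1 \<in> sets borel" "B2 \<in> sets borel"
    unfolding B1_def B2_def using B(1) \<theta> by measurable
  have B12_un: "B1 \<union> B2 = B" "B1 \<inter> B2 = {}"
    by (auto simp: B1_def B2_def less_top)

  \<comment> \<open>The set of infinite density\<close>
  have S_B2: "\<S> B2 = 0"
  proof -
    \<comment> \<open>On \<open>V i\<close> every multiple
      \<open>of_nat n * \<S> (B2 \<inter> V i)\<close> stays below the finite number
      \<open>\<mu> (V i)\<close>.\<close>
    have "\<S> (B2 \<inter> V i) = 0" for i
    proof -
      have meas: "B2 \<inter> V i \<in> sets borel"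
        using B12(2) V(1)[of i] by auto
      have le: "of_nat n * \<S> (B2 \<inter> V i) \<le> \<mu> (V i)" for n
      proof -
        have "of_nat n * \<S> (B2 \<inter> V i) \<le> \<mu> (B2 \<inter> V i)"
          by (rule lower[OF _ meas]) (auto simp: B2_def of_nat_less_top)
        also have "\<dots> \<le> \<mu> (V i)"
          by (intro outer_measure_mono[OF \<mu>]) auto
        finally show ?thesis .
      qed
      show ?thesis
      proof (rule ccontr)
        assume nz: "\<S> (B2 \<inter> V i) \<noteq> 0"
        have "\<mu> (V i) / \<S> (B2 \<inter> V i) < top"
          using V(2)[of i] nz by (simp add: less_top[symmetric] ennreal_divide_eq_top_iff)
        then obtain n :: nat where n: "\<mu> (V i) / \<S> (B2 \<inter> V i) < of_nat n"
          by (metis ennreal_Ex_less_of_nat)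
        \<comment> \<open>The bound for \<open>n = 1\<close> gives the finiteness needed to clear
          the denominator.\<close>
        have "\<S> (B2 \<inter> V i) < top"
          using le[of 1] V(2)[of i] by (auto intro: le_less_trans)
        with n nz have "\<mu> (V i) < of_nat n * \<S> (B2 \<inter> V i)"
          by (simp add: divide_less_ennreal)
        with le[of n] show False
          by simp
      qed
    qed
    moreover have "B2 = (\<Union>i. B2 \<inter> V i)"
      using V(3) by (simp flip: Int_UN_distrib)
    ultimately have "\<S> B2 \<le> (\<Sum>i::nat. 0)"
      using outer_measure_UN_le[OF S, of "\<lambda>i. B2 \<inter> V i"] by simp
    then show ?thesis
      by simp
  qed
  \<comment> \<open>Absolute continuity enters here: it forbids mass of \<open>\<mu>\<close> on the
    null set of infinite density.\<close>
  have \<mu>_B2: "\<mu> B2 = 0"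
  proof -
    have "A \<inter> B2 = B2"
      using B(2) by (auto simp: B2_def)
    then show ?thesis
      using ac S_B2 unfolding outer_absolutely_continuous_def outer_restrict_def \<S>_def by metis
  qed
  have D_B2: "emeasure D B2 = 0"
  proof -
    have "B2 \<in> null_sets N"
      using S_B2 B12(2) by (simp add: null_sets_def N)
    then show ?thesis
      using absolutely_continuousI_density[OF \<theta>_N] unfolding absolutely_continuous_def D_def by auto
  qed

  \<comment> \<open>Layers of the set of finite density\<close>
  have S_B1: "\<S> B1 < top"
  proof -
    have "\<S> B1 \<le> \<S> A"
      using B(2) by (intro outer_measure_mono[OF S]) (auto simp: B1_def)
    then show ?thesis
      using S_fin by (simp add: \<S>_def le_less_trans)
  qed
  have layers: "emeasure M B1 \<le> emeasure D B1 + ennreal \<eta> * \<S> B1"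
      "emeasure D B1 \<le> emeasure M B1 + ennreal \<eta> * (2 * \<S> B1)" if \<eta>: "\<eta> > 0" for \<eta> :: real
  proof -
    \<comment> \<open>Half-open layers of height \<open>\<eta>\<close> are disjoint, and finiteness
      of the density makes them exhaust \<open>B1\<close>.\<close>
    define E where "E k = B1 \<inter> {x. ennreal (real k * \<eta>) \<le> \<theta> x \<and> \<theta> x < ennreal (real (Suc k) * \<eta>)}" for k
    have E: "E k \<in> sets borel" for k
      unfolding E_def using B12(1) \<theta> by measurable
    have un: "(\<Union>k. E k) = B1"
    proof (intro equalityI subsetI)
      fix x assume x: "x \<in> B1"
      then obtain r where r: "\<theta> x = ennreal r" "r \<ge> 0"
        by (cases "\<theta> x") (auto simp: B1_def)
      define k where "k = nat \<lfloor>r / \<eta>\<rfloor>"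
      have "real k \<le> r / \<eta>" "r / \<eta> < real (Suc k)"
        using r(2) \<eta> by (auto simp: k_def) linarith
      then have "real k * \<eta> \<le> r" "r < real (Suc k) * \<eta>"
        using \<eta> by (simp_all add: pos_le_divide_eq pos_divide_less_eq)
      then have "x \<in> E k"
        using x r \<eta> by (simp add: E_def ennreal_leI ennreal_less_iff)
      then show "x \<in> (\<Union>k. E k)"
        by blast
    qed (auto simp: E_def)
    have disj: "disjoint_family E"
      unfolding disjoint_family_on_def
    proof (intro ballI impI, rule ccontr)
      fix i j assume "i \<noteq> j" "E i \<inter> E j \<noteq> {}"
      then obtain x where x: "ennreal (real i * \<eta>) \<le> \<theta> x" "\<theta> x < ennreal (real (Suc i) * \<eta>)"
          "ennreal (real j * \<eta>) \<le> \<theta> x" "\<theta> x < ennreal (real (Suc j) * \<eta>)"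
        unfolding E_def by blast
      have "real i * \<eta> < real (Suc j) * \<eta>" "real j * \<eta> < real (Suc i) * \<eta>"
        using le_less_trans[OF x(1,4)] le_less_trans[OF x(3,2)] \<eta> by (simp_all add: ennreal_less_iff)
      then have "i < Suc j" "j < Suc i"
        using \<eta> by simp_all
      with \<open>i \<noteq> j\<close> show False
        by simp
    qed
    have sum: "emeasure X B1 = (\<Sum>k. emeasure X (E k))" if "sets X = sets borel" for X
      using E disj that by (subst un[symmetric], intro suminf_emeasure[symmetric]) auto
    have "emeasure N B1 = (\<Sum>k. \<S> (E k))"
      using sum[of N] E by (simp add: N)
    then have sum_S: "\<S> B1 = (\<Sum>k. \<S> (E k))"
      using B12(1) by (simp add: N)
    have D_ge: "ennreal (real k * \<eta>) * \<S> (E k) \<le> emeasure D (E k)" for k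
    proof -
      have "ennreal (real k * \<eta>) * \<S> (E k) = (\<integral>\<^sup>+x. ennreal (real k * \<eta>) * indicator (E k) x \<partial>N)"
        using E[of k] by (simp add: nn_integral_cmult_indicator N)
      also have "\<dots> \<le> (\<integral>\<^sup>+x. \<theta> x * indicator (E k) x \<partial>N)"
        by (intro nn_integral_mono) (auto simp: E_def split: split_indicator)
      finally show ?thesis
        by (simp add: D E)
    qed
    have D_le: "emeasure D (E k) \<le> ennreal (real (Suc k) * \<eta>) * \<S> (E k)" for k
    proof -
      have "emeasure D (E k) \<le> (\<integral>\<^sup>+x. ennreal (real (Suc k) * \<eta>) * indicator (E k) x \<partial>N)"
        unfolding D[OF E] by (intro nn_integral_mono) (auto simp: E_def less_imp_le split: split_indicator)
      also have "\<dots> = ennreal (real (Suc k) * \<eta>) * \<S> (E k)"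
        using E[of k] by (simp add: nn_integral_cmult_indicator N del: of_nat_Suc)
      finally show ?thesis .
    qed
    have split: "ennreal (real (Suc k) * \<eta>) * s = ennreal (real k * \<eta>) * s + ennreal \<eta> * s" for k s
    proof -
      have "ennreal (real (Suc k) * \<eta>) = ennreal (real k * \<eta>) + ennreal \<eta>"
        using \<eta> by (subst ennreal_plus[symmetric]) (auto simp: distrib_right add.commute)
      then show ?thesis
        by (simp only: distrib_right)
    qed
    have "emeasure M (E k) \<le> emeasure D (E k) + ennreal \<eta> * \<S> (E k)" for k
    proof -
      have "emeasure M (E k) \<le> ennreal (real (Suc k) * \<eta>) * \<S> (E k)"
        unfolding M[OF E] by (rule upper) (auto simp: E_def)
      then show ?thesis
        unfolding split by (rule order_trans) (rule add_right_mono[OF D_ge])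
    qed
    then have "(\<Sum>k. emeasure M (E k)) \<le> (\<Sum>k. emeasure D (E k) + ennreal \<eta> * \<S> (E k))"
      by (intro suminf_le) auto
    also have "\<dots> = (\<Sum>k. emeasure D (E k)) + ennreal \<eta> * (\<Sum>k. \<S> (E k))"
      by (subst suminf_add[symmetric]) auto
    finally show "emeasure M B1 \<le> emeasure D B1 + ennreal \<eta> * \<S> B1"
      by (simp add: sum sum_S)
    have "emeasure D (E k) \<le> emeasure M (E k) + ennreal \<eta> * (2 * \<S> (E k))" for k
    proof -
      \<comment> \<open>\<open>lower\<close> needs a strict inequality, while on \<open>E k\<close>
        the density may equal \<open>k * \<eta>\<close>. The level below is used instead, at the
        cost of a second \<open>\<eta>\<close>; for \<open>k = 0\<close> the left side is 0.\<close>
      have "ennreal (real k * \<eta>) * \<S> (E k) \<le> emeasure M (E k) + ennreal \<eta> * \<S> (E k)"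
      proof (cases k)
        case (Suc m)
        have "ennreal (real m * \<eta>) * \<S> (E k) \<le> emeasure M (E k)"
          unfolding M[OF E]
        proof (rule lower[OF _ E])
          fix x assume "x \<in> E k"
          then have "ennreal (real (Suc m) * \<eta>) \<le> \<theta> x"
            by (simp add: E_def Suc)
          moreover have "ennreal (real m * \<eta>) < ennreal (real (Suc m) * \<eta>)"
            using \<eta> by (simp add: ennreal_less_iff)
          ultimately show "ennreal (real m * \<eta>) < \<theta> x"
            by (rule less_le_trans[rotated])
        qed simp
        then show ?thesis
          unfolding Suc split by (rule add_right_mono)
      qed simp
      then have "ennreal (real (Suc k) * \<eta>) * \<S> (E k) \<le> emeasure M (E k) + ennreal \<eta> * \<S> (E k) + ennreal \<eta> * \<S> (E k)"
        unfolding split by (rule add_right_mono)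
      with D_le[of k] show ?thesis
        by (simp add: mult_2 distrib_left add.assoc)
    qed
    then have "(\<Sum>k. emeasure D (E k)) \<le> (\<Sum>k. emeasure M (E k) + ennreal \<eta> * (2 * \<S> (E k)))"
      by (intro suminf_le) auto
    also have "\<dots> = (\<Sum>k. emeasure M (E k)) + ennreal \<eta> * (2 * (\<Sum>k. \<S> (E k)))"
      by (subst suminf_add[symmetric]) auto
    finally show "emeasure D B1 \<le> emeasure M B1 + ennreal \<eta> * (2 * \<S> B1)"
      by (simp add: sum sum_S)
  qed

  \<comment> \<open>Vanishing layer width and passage to the Caratheodory measure\<close>
  have "emeasure M B1 = emeasure D B1"
  proof (rule antisym)
    show "emeasure M B1 \<le> emeasure D B1"
      using S_B1 layers(1) by (rule ennreal_le_of_le_add_mult)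
    show "emeasure D B1 \<le> emeasure M B1"
    proof (rule ennreal_le_of_le_add_mult[OF _ layers(2)])
      show "2 * \<S> B1 < top"
        unfolding mult_2 using S_B1 by simp
    qed
  qed
  moreover have "emeasure X B = emeasure X B1 + emeasure X B2" if "sets X = sets borel" for X
    using plus_emeasure[of B1 X B2] B12 B12_un that by simp
  ultimately have "emeasure M B = emeasure D B"
    using \<mu>_B2 D_B2 B12(2) by (simp add: M)
  then have "\<mu> B = (\<integral>\<^sup>+x. \<theta> x * indicator B x \<partial>N)"
    using B(1) by (simp add: M D)
  \<comment> \<open>The integrand is Borel, so integration against the pushforward along the
    identity agrees with integration on the larger sigma-algebra.\<close>
  also have "\<dots> = (\<integral>\<^sup>+x. \<theta> x * indicator B x \<partial>caratheodory_measure \<S>)"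
    unfolding N_def borel_restriction_def
  proof (rule nn_integral_distr)
    show "(\<lambda>x. x) \<in> measurable (caratheodory_measure \<S>) borel"
      using bor_S by (auto simp: measurable_def sets_caratheodory_measure[OF S] space_caratheodory_measure[OF S])
    have "(\<lambda>x. \<theta> x * indicator B x) \<in> borel_measurable borel"
      using \<theta> B(1) by measurable
    then show "(\<lambda>x. \<theta> x * indicator B x) \<in> borel_measurable (distr (caratheodory_measure \<S>) borel (\<lambda>x. x))"
      by simp
  qed
  finally show "\<mu> B = (\<integral>\<^sup>+x\<in>B. spherical_density c\<^sub>\<alpha> \<alpha> \<mu> x
               \<partial>caratheodory_measure (spherical_hausdorff c\<^sub>\<alpha> \<alpha>))"
    by (simp add: \<theta>_def \<S>_def)
qed

end
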